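(* Let $k$ be a positive integer and let $G$ be a graph satisfying the NC property which is the union of $k$ pairwise edge-disjoint copies of $K_k$ (i.e. there are complete subgraphs $L_1,\dots,L_k$ of $G$, each on $k$ vertices, pairwise edge-disjoint, with $V(G)=\bigcup_i V(L_i)$ and $E(G)=\bigcup_i E(L_i)$). Then $\chi_{DP}(G)=k$.
   Context: All graphs are finite and simple; $\chi_{DP}$ is the DP-chromatic (correspondence chromatic) number. A hole of $G$ is an induced cycle of length at least $4$; $\mathcal H(G)$ is the set of holes and $\mathcal H(G,u)$ the set of holes containing $u$. A hole cover of $G$ is a nonempty $X\subseteq V(G)$ meeting every hole. A vertex $u$ satisfies the NC property in $G$ if there are no holes $H\in\mathcal H(G,u)$, $H'\in\mathcal H(G)\setminus\mathcal H(G,u)$ sharing two consecutive edges (two distinct edges with a common end vertex lying on both). A set $\mathcal C$ satisfies the NC property in $G$ if each of its vertices does and every hole contains at most one vertex of $\mathcal C$. A graph satisfies the NC property if it has a hole cover satisfying the NC property in it. *)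

theory Defs
  imports Main
begin

definition simple_graph :: "'a set \<Rightarrow> 'a set set \<Rightarrow> bool" where
  "simple_graph V E \<longleftrightarrow> finite V \<and>
     (\<forall>e\<in>E. \<exists>x y. x \<noteq> y \<and> x \<in> V \<and> y \<in> V \<and> e = {x, y})"

definition clique_edges :: "'a set \<Rightarrow> 'a set set" where
  "clique_edges S = {e. \<exists>x y. x \<noteq> y \<and> x \<in> S \<and> y \<in> S \<and> e = {x, y}}"

text \<open>A hole: the vertex set of an induced cycle of length at least 4
  (an induced cycle is determined by its vertex set).\<close>
definition is_hole :: "'a set \<Rightarrow> 'a set set \<Rightarrow> 'a set \<Rightarrow> bool" where
  "is_hole V E S \<longleftrightarrow> (\<exists>xs. distinct xs \<and> length xs \<ge> 4 \<and> set xs = S \<and> S \<subseteq> V \<and>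
     (\<forall>i < length xs. \<forall>j < length xs.
        {xs ! i, xs ! j} \<in> E \<longleftrightarrow>
          (j = Suc i mod length xs \<or> i = Suc j mod length xs)))"

definition hole_cover :: "'a set \<Rightarrow> 'a set set \<Rightarrow> 'a set \<Rightarrow> bool" where
  "hole_cover V E X \<longleftrightarrow> X \<noteq> {} \<and> X \<subseteq> V \<and>
     (\<forall>H. is_hole V E H \<longrightarrow> H \<inter> X \<noteq> {})"

text \<open>Two holes share two consecutive edges: there are distinct edges xy, yz
  (with common end y) lying on both holes; edges of a hole are the edges of G
  induced on it.\<close>
definition share_two_consecutive_edges :: "'a set set \<Rightarrow> 'a set \<Rightarrow> 'a set \<Rightarrow> bool" where
  "share_two_consecutive_edges E H H' \<longleftrightarrow>
     (\<exists>x y z. x \<noteq> z \<and> {x, y} \<in> E \<and> {y, z} \<in> E \<and>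
        x \<in> H \<and> y \<in> H \<and> z \<in> H \<and> x \<in> H' \<and> y \<in> H' \<and> z \<in> H')"

definition vertex_NC :: "'a set \<Rightarrow> 'a set set \<Rightarrow> 'a \<Rightarrow> bool" where
  "vertex_NC V E u \<longleftrightarrow> \<not> (\<exists>H H'. is_hole V E H \<and> u \<in> H \<and> is_hole V E H' \<and> u \<notin> H' \<and>
        share_two_consecutive_edges E H H')"

definition set_NC :: "'a set \<Rightarrow> 'a set set \<Rightarrow> 'a set \<Rightarrow> bool" where
  "set_NC V E C \<longleftrightarrow> (\<forall>u\<in>C. vertex_NC V E u) \<and>
     (\<forall>H. is_hole V E H \<longrightarrow> card (H \<inter> C) \<le> 1)"

definition graph_NC :: "'a set \<Rightarrow> 'a set set \<Rightarrow> bool" where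
  "graph_NC V E \<longleftrightarrow> (\<exists>X. hole_cover V E X \<and> set_NC V E X)"

definition cover_list :: "'a \<Rightarrow> nat \<Rightarrow> ('a \<times> nat) set" where
  "cover_list v m = {v} \<times> {0..<m}"

definition dp_cover :: "'a set \<Rightarrow> 'a set set \<Rightarrow> nat \<Rightarrow> ('a \<times> nat) set set \<Rightarrow> bool" where
  "dp_cover V E m HE \<longleftrightarrow>
     simple_graph (V \<times> {0..<m}) HE \<and>
     (\<forall>u\<in>V. clique_edges (cover_list u m) \<subseteq> HE) \<and>
     (\<forall>u\<in>V. \<forall>v\<in>V. u \<noteq> v \<longrightarrow> {u, v} \<notin> E \<longrightarrow>
        (\<forall>a\<in>cover_list u m. \<forall>b\<in>cover_list v m. {a, b} \<notin> HE)) \<and>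
     (\<forall>u\<in>V. \<forall>v\<in>V. u \<noteq> v \<longrightarrow>
        (\<forall>a\<in>cover_list u m. card {b \<in> cover_list v m. {a, b} \<in> HE} \<le> 1))"

definition dp_colouring :: "'a set \<Rightarrow> nat \<Rightarrow> ('a \<times> nat) set set \<Rightarrow> ('a \<times> nat) set \<Rightarrow> bool" where
  "dp_colouring V m HE I \<longleftrightarrow> I \<subseteq> V \<times> {0..<m} \<and>
     (\<forall>a\<in>I. \<forall>b\<in>I. {a, b} \<notin> HE) \<and>
     (\<forall>v\<in>V. card (I \<inter> cover_list v m) = 1)"

definition dp_colourable :: "'a set \<Rightarrow> 'a set set \<Rightarrow> nat \<Rightarrow> bool" where
  "dp_colourable V E m \<longleftrightarrow>
     (\<forall>HE. dp_cover V E m HE \<longrightarrow> (\<exists>I. dp_colouring V m HE I))"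

definition chi_DP :: "'a set \<Rightarrow> 'a set set \<Rightarrow> nat" where
  "chi_DP V E = (LEAST m. dp_colourable V E m)"

end

theory Submission
  imports Defs Complex_Main
begin

text \<open>The lower bound comes from a single \<open>K\<^sub>k\<close>.  For the upper bound it suffices that \<open>G\<close> is
  \<open>(k - 1)\<close>-degenerate, since greedy colouring works for DP-colouring too.  A vertex in only one \<open>L i\<close> has
  degree \<open>k - 1\<close>, so consider a nonempty set \<open>W\<close> of vertices lying in at least two.  If \<open>W\<close> contains a
  \<open>k\<close>-clique, the equality case of the de Bruijn--Erdos theorem shows that \<open>W\<close> is that clique.  Otherwise
  all cliques in \<open>W\<close> have at most \<open>k - 1\<close> vertices, and one shows that a graph with the NC property and
  cliques of size at most \<open>m\<close> has a vertex of degree at most \<open>m\<close>: splitting along clique cutsets one may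
  assume there are none, and then a vertex \<open>u\<close> of the hole cover which lies on some hole lies on every
  hole.  So \<open>G - u\<close> is chordal, and a simplicial vertex of it has degree at most \<open>m\<close>.\<close>

section \<open>Connected sets, cliques and induced paths\<close>

text \<open>The hard point is that \<open>u\<close> lies on every hole. The NC property only forbids
  a hole through \<open>u\<close> and a hole avoiding \<open>u\<close> to share an induced path on
  three vertices, so such a pair has to be built. A hole avoiding \<open>u\<close> is enclosed in a
  minimal set \<open>B\<close> to which the rest of \<open>V - {u}\<close> attaches along cliques
  only. A hole that shares three consecutive vertices with a hole of \<open>B\<close> and makes a
  detour outside \<open>B\<close> is then impossible: through \<open>u\<close> it violates NC, and
  avoiding \<open>u\<close> it would be separated by a clique. The obstacle is that a connected set
  with two nonadjacent attachments on a hole need not offer such a detour: it may contain a vertex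
  adjacent to the whole hole (a hub), or a path forming a prism with a 4-hole. Here it matters that
  the cover meets each hole exactly once: this excludes prisms and makes two hubs of one hole
  adjacent. Putting \<open>u\<close> back costs one: a simplicial vertex has degree at most
  \<open>m - 1\<close> in \<open>V - {u}\<close>, hence at most \<open>m\<close> in
  \<open>V\<close>. With \<open>m = k - 1\<close> this leaves no slack, which is why
  \<open>k\<close>-cliques among the vertices on several \<open>L i\<close> need a separate
  argument.\<close>

locale sym_graph =
  fixes adj :: "'a \<Rightarrow> 'a \<Rightarrow> bool"
  assumes adj_sym: "adj x y \<Longrightarrow> adj y x"
    and adj_irrefl: "\<not> adj x x"
begin

lemma adj_commute: "adj x y \<longleftrightarrow> adj y x"
  using adj_sym by blast

definition clq :: "'a set \<Rightarrow> bool" where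
  "clq K \<longleftrightarrow> (\<forall>x\<in>K. \<forall>y\<in>K. x \<noteq> y \<longrightarrow> adj x y)"

definition att :: "'a set \<Rightarrow> 'a set" where
  "att D = {x. \<exists>d\<in>D. adj d x}"

text \<open>Phrased by closed subsets instead of paths: connectivity is applied by exhibiting one
  nonempty closed subset and a point outside it. The empty set is connected, so removing all of a
  clique is no cut and cliques are atoms.\<close>

definition conn :: "'a set \<Rightarrow> bool" where
  "conn S \<longleftrightarrow> (\<forall>T. T \<subseteq> S \<longrightarrow> T \<noteq> {} \<longrightarrow> att T \<inter> S \<subseteq> T \<longrightarrow> T = S)"

text \<open>An atom is a set without clique cutset (it is connected, by taking \<open>K = {}\<close>).\<close>

definition atom :: "'a set \<Rightarrow> bool" where
  "atom B \<longleftrightarrow> (\<forall>K. K \<subseteq> B \<longrightarrow> clq K \<longrightarrow> conn (B - K))"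

lemma clq_subset: "clq K \<Longrightarrow> K' \<subseteq> K \<Longrightarrow> clq K'"
  unfolding clq_def by blast

lemma clqD: "clq K \<Longrightarrow> x \<in> K \<Longrightarrow> y \<in> K \<Longrightarrow> x \<noteq> y \<Longrightarrow> adj x y"
  unfolding clq_def by blast

lemma not_clqE:
  assumes "\<not> clq K"
  obtains x y where "x \<in> K" "y \<in> K" "x \<noteq> y" "\<not> adj x y"
  using assms unfolding clq_def by blast

lemma connD: "conn S \<Longrightarrow> T \<subseteq> S \<Longrightarrow> t \<in> T \<Longrightarrow> att T \<inter> S \<subseteq> T \<Longrightarrow> T = S"
  unfolding conn_def by blast

lemma conn_Un:
  assumes "conn S" "conn T" "s \<in> S" "t \<in> T" "s = t \<or> adj s t"
  shows "conn (S \<union> T)"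
  unfolding conn_def
proof (intro allI impI)
  fix U assume U: "U \<subseteq> S \<union> T" "U \<noteq> {}" "att U \<inter> (S \<union> T) \<subseteq> U"
  have S: "S \<subseteq> U" if "x \<in> U \<inter> S" for x
  proof -
    have "att (U \<inter> S) \<inter> S \<subseteq> U \<inter> S" using U(3) unfolding att_def by blast
    then show ?thesis using connD[OF assms(1), of "U \<inter> S" x] that by blast
  qed
  have T: "T \<subseteq> U" if "x \<in> U \<inter> T" for x
  proof -
    have "att (U \<inter> T) \<inter> T \<subseteq> U \<inter> T" using U(3) unfolding att_def by blast
    then show ?thesis using connD[OF assms(2), of "U \<inter> T" x] that by blast
  qed
  have st: "s \<in> U \<longleftrightarrow> t \<in> U"
    using U(3) assms(3-5) adj_sym unfolding att_def by blast
  show "U = S \<union> T"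
    using S T st U(1,2) assms(3,4) by blast
qed

lemma conn_single: "conn {a}"
  unfolding conn_def by blast

lemma conn_insert:
  assumes "conn S" "s \<in> S" "adj s a"
  shows "conn (insert a S)"
  using conn_Un[OF assms(1) conn_single[of a] assms(2)] assms(3) by simp

lemma component_exists:
  assumes "x \<in> S"
  obtains C where "x \<in> C" "C \<subseteq> S" "conn C" "att C \<inter> S \<subseteq> C"
proof -
  define C where "C = \<Inter>{T. x \<in> T \<and> T \<subseteq> S \<and> att T \<inter> S \<subseteq> T}"
  have least: "C \<subseteq> T" if "x \<in> T" "T \<subseteq> S" "att T \<inter> S \<subseteq> T" for T
    using that unfolding C_def by blast
  have xC: "x \<in> C" unfolding C_def by blast
  have CS: "C \<subseteq> S" using least[of S] assms by blast
  have cl: "att C \<inter> S \<subseteq> C" unfolding C_def att_def by blast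
  have "conn C"
    unfolding conn_def
  proof (intro allI impI)
    fix T assume T: "T \<subseteq> C" "T \<noteq> {}" "att T \<inter> C \<subseteq> T"
    have 1: "att T \<inter> S \<subseteq> T" using T cl CS unfolding att_def by blast
    \<comment> \<open>By symmetry of adjacency the complement of a closed part is closed too.
      Whichever of \<open>T\<close> and \<open>C - T\<close> contains \<open>x\<close> is all of
      \<open>C\<close>, by minimality of \<open>C\<close>.\<close>
    have 2: "att (C - T) \<inter> S \<subseteq> C - T"
    proof
      fix z assume z: "z \<in> att (C - T) \<inter> S"
      then obtain y where y: "y \<in> C - T" "adj y z" unfolding att_def by blast
      have "z \<in> C" using cl z y unfolding att_def by blast
      moreover have "z \<notin> T" using T(3) y adj_sym unfolding att_def by blast
      ultimately show "z \<in> C - T" by blast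
    qed
    show "T = C"
    proof (cases "x \<in> T")
      case True then show ?thesis using least[OF _ _ 1] T(1) CS by blast
    next
      case False
      then show ?thesis using least[OF _ _ 2] xC T(1,2) CS by blast
    qed
  qed
  then show ?thesis using that xC CS cl by blast
qed

text \<open>Attachments forming a clique would be a clique cutset separating \<open>C\<close> from
  the unattached vertex \<open>y\<close>.\<close>

lemma atom_attach:
  assumes "atom B" "C \<subseteq> B" "c \<in> C" "y \<in> B - C" "y \<notin> att C"
  obtains a b where "a \<in> att C \<inter> (B - C)" "b \<in> att C \<inter> (B - C)" "a \<noteq> b" "\<not> adj a b"
proof -
  define K where "K = att C \<inter> (B - C)"
  have "\<not> clq K"
  proof
    assume "clq K"
    moreover have "K \<subseteq> B" unfolding K_def by blast
    ultimately have 1: "conn (B - K)" using assms(1) unfolding atom_def by simp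
    have 2: "C \<subseteq> B - K" using assms(2) unfolding K_def by blast
    have 3: "att C \<inter> (B - K) \<subseteq> C" unfolding K_def by blast
    have "C = B - K" by (rule connD[OF 1 2 assms(3) 3])
    then show False using assms(4,5) unfolding K_def by blast
  qed
  then obtain a b where "a \<in> K" "b \<in> K" "a \<noteq> b" "\<not> adj a b" by (rule not_clqE)
  then show ?thesis using that unfolding K_def by simp
qed

text \<open>Each vertex is compared with the whole rest of the list, so the recursion itself rules
  out chords. The value \<open>hd []\<close> is never consulted, as the last vertex has no
  successors.\<close>

fun ipath :: "'a list \<Rightarrow> bool" where
  "ipath [] = True"
| "ipath (x # xs) = (ipath xs \<and> x \<notin> set xs \<and> (\<forall>y\<in>set xs. adj x y \<longleftrightarrow> y = hd xs))"

lemma ipath_distinct: "ipath xs \<Longrightarrow> distinct xs"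
  by (induction xs) auto

lemma ipath_suffix: "ipath (xs @ ys) \<Longrightarrow> ipath ys"
  by (induction xs) auto

lemma ipath_prefix: "ipath (xs @ ys) \<Longrightarrow> ipath xs"
proof (induction xs)
  case (Cons x xs)
  then show ?case by (cases xs) auto
qed simp

lemma ipath_snoc:
  "ipath (xs @ [a]) \<longleftrightarrow> ipath xs \<and> a \<notin> set xs \<and> (\<forall>y\<in>set xs. adj y a \<longleftrightarrow> y = last xs)"
proof (induction xs)
  case (Cons x xs)
  show ?case
  proof (cases xs)
    case Nil then show ?thesis by auto
  next
    case (Cons z zs)
    then show ?thesis using Cons.IH by (auto split: if_splits)
  qed
qed simp

lemma ipath_rev: "ipath xs \<Longrightarrow> ipath (rev xs)"
proof (induction xs)
  case (Cons x xs)
  then show ?case by (auto simp: ipath_snoc last_rev adj_commute)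
qed simp

lemma ipath_gap:
  assumes "ipath (us @ vs @ ws)" "vs \<noteq> []" "x \<in> set us" "y \<in> set ws"
  shows "x \<noteq> y \<and> \<not> adj x y"
  using assms
proof (induction us)
  case (Cons u us)
  show ?case
  proof (cases "x = u")
    case True
    have "hd (us @ vs @ ws) \<in> set (us @ vs)" using Cons.prems(2) by (cases us) auto
    moreover have "distinct (us @ vs @ ws)" using Cons.prems(1) ipath_distinct[of "us @ vs @ ws"] by simp
    ultimately have "hd (us @ vs @ ws) \<noteq> y" using Cons.prems(4) by auto
    then show ?thesis using True Cons.prems by auto
  next
    case False then show ?thesis using Cons by auto
  qed
qed simp

lemma conn_ipath: "ipath xs \<Longrightarrow> conn (set xs)"
proof (induction xs)
  case Nil then show ?case unfolding conn_def by simp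
next
  case (Cons x xs)
  show ?case
  proof (cases xs)
    case Nil then show ?thesis using conn_single by simp
  next
    case (Cons y ys)
    then have "adj y x" using Cons.prems adj_sym by auto
    then show ?thesis using Cons conn_insert[of "set xs" y x] Cons.IH Cons.prems by auto
  qed
qed

lemma ipath_exists:
  assumes "conn S" "p \<in> S" "q \<in> S"
  obtains xs where "ipath xs" "xs \<noteq> []" "hd xs = p" "last xs = q" "set xs \<subseteq> S"
proof -
  define R where "R y xs \<longleftrightarrow> ipath xs \<and> xs \<noteq> [] \<and> hd xs = y \<and> last xs = q \<and> set xs \<subseteq> S" for y xs
  define T where "T = {y \<in> S. \<exists>xs. R y xs}"
  have "q \<in> T" using assms(3) unfolding T_def R_def by (auto intro!: exI[of _ "[q]"])
  moreover have "att T \<inter> S \<subseteq> T"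
  proof
    fix y assume "y \<in> att T \<inter> S"
    then obtain x xs where y: "y \<in> S" "adj x y" "R x xs" unfolding T_def att_def by blast
    have "\<exists>zs. R y zs"
    proof (cases "y \<in> set xs")
      case True
      then obtain as bs where "xs = as @ y # bs" by (meson split_list)
      then have "R y (y # bs)" using y(3) unfolding R_def by (auto dest: ipath_suffix)
      then show ?thesis by blast
    next
      case False
      \<comment> \<open>Joining \<open>y\<close> to its last neighbour on the path creates no chord,
        so no appeal to shortest paths is needed.\<close>
      have "\<exists>z\<in>set xs. adj y z" using y adj_sym unfolding R_def by (metis hd_in_set)
      then obtain as z bs where z: "xs = as @ z # bs" "adj y z" "\<forall>w\<in>set bs. \<not> adj y w"
        using split_list_last_prop[of xs "adj y"] by blast
      then have "ipath (z # bs)" using y(3) ipath_suffix unfolding R_def by blast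
      then have "R y (y # z # bs)" using y(1,3) z False unfolding R_def by auto
      then show ?thesis by blast
    qed
    then show "y \<in> T" using y(1) unfolding T_def by blast
  qed
  ultimately have "T = S" using connD[OF assms(1), of T q] unfolding T_def by blast
  then show ?thesis using assms(2) that unfolding T_def R_def by blast
qed

section \<open>Holes\<close>

text \<open>The cycle is cut open at \<open>a\<close>, which reduces questions on holes to questions
  on induced paths; \<open>hole_at_any\<close> allows the cut at any vertex. Three path vertices
  plus \<open>a\<close> give the length bound 4.\<close>

definition hole_at :: "'a \<Rightarrow> 'a list \<Rightarrow> bool" where
  "hole_at a xs \<longleftrightarrow> ipath xs \<and> length xs \<ge> 3 \<and> a \<notin> set xs \<and>
     (\<forall>y\<in>set xs. adj a y \<longleftrightarrow> y = hd xs \<or> y = last xs)"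

definition hole :: "'a set \<Rightarrow> bool" where
  "hole H \<longleftrightarrow> (\<exists>a xs. hole_at a xs \<and> H = insert a (set xs))"

lemma hole_at_rotate:
  assumes "hole_at a (x # xs)"
  shows "hole_at x (xs @ [a])"
proof -
  have "xs \<noteq> []" using assms unfolding hole_at_def by auto
  then have l: "last (x # xs) = last xs" "last xs \<in> set xs" "hd (xs @ [a]) = hd xs" by auto
  have x: "adj x a" "x \<notin> set xs" using assms adj_sym unfolding hole_at_def by auto
  have a: "\<forall>y\<in>set xs. adj y a \<longleftrightarrow> y = last xs"
  proof
    fix y assume "y \<in> set xs"
    then show "adj y a \<longleftrightarrow> y = last xs"
      using assms l x(2) adj_commute[of y a] unfolding hole_at_def by auto
  qed
  have "x \<noteq> a" "a \<notin> set xs" "ipath xs" "length xs \<ge> 2" "\<forall>y\<in>set xs. adj x y \<longleftrightarrow> y = hd xs"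
    using assms unfolding hole_at_def by auto
  then show ?thesis
    using l a x unfolding hole_at_def ipath_snoc by auto
qed

lemma hole_at_rev: "hole_at a xs \<Longrightarrow> hole_at a (rev xs)"
  unfolding hole_at_def by (auto simp: ipath_rev hd_rev last_rev)

lemma hole_at_any:
  assumes "hole H" "a \<in> H"
  obtains xs where "hole_at a xs" "H = insert a (set xs)"
proof -
  have *: "\<exists>xs. hole_at b xs \<and> insert c (set (us @ b # vs)) = insert b (set xs)"
    if "hole_at c (us @ b # vs)" for b c us vs
    using that
  proof (induction us arbitrary: c vs)
    case Nil
    then show ?case using hole_at_rotate[of c b vs] by (intro exI[of _ "vs @ [c]"]) auto
  next
    case (Cons u us)
    have "hole_at u (us @ b # (vs @ [c]))" using hole_at_rotate[of c u "us @ b # vs"] Cons.prems by simp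
    from Cons.IH[OF this] show ?case by (auto simp: insert_commute)
  qed
  obtain c ys where c: "hole_at c ys" "H = insert c (set ys)" using assms(1) unfolding hole_def by blast
  show ?thesis
  proof (cases "a = c")
    case True then show ?thesis using that c by blast
  next
    case False
    then obtain us vs where "ys = us @ a # vs" using assms(2) c by (metis insertE split_list)
    then obtain xs where "hole_at a xs" "H = insert a (set xs)" using *[of c us a vs] c by auto
    then show ?thesis by (rule that)
  qed
qed

lemma hole_nbrs:
  assumes "hole H" "a \<in> H"
  obtains p q r where "p \<in> H" "q \<in> H" "r \<in> H" "p \<noteq> q" "\<not> adj p q" "adj a p" "adj a q"
    "r \<noteq> a" "\<not> adj a r"
proof -
  obtain xs where xs: "hole_at a xs" "H = insert a (set xs)" using assms by (rule hole_at_any)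
  then obtain p r s ys where e: "xs = p # r # s # ys" unfolding hole_at_def
    by (metis Suc_le_length_iff numeral_3_eq_3)
  let ?q = "last (s # ys)"
  have q: "?q \<in> set (s # ys)" by (rule last_in_set) simp
  have l: "last xs = ?q" "hd xs = p" using e by auto
  have d: "ipath xs" "distinct xs" "a \<notin> set xs" using xs ipath_distinct unfolding hole_at_def by auto
  have "p \<noteq> ?q" "\<not> adj p ?q" using d q e by auto
  moreover have "adj a p" "adj a ?q" "\<not> adj a r" using xs(1) l e q d unfolding hole_at_def by auto
  moreover have "r \<noteq> a" using d e by auto
  ultimately show ?thesis using that[of p ?q r] q e xs(2) by auto
qed

lemma hole_not_clq: "hole H \<Longrightarrow> \<not> clq H"
  using hole_nbrs[of H] unfolding hole_def clq_def by (metis insertI1)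

text \<open>A clique meets a hole in at most two vertices, and these are consecutive, so what
  remains is the whole cycle or a path. This is the basic tool for keeping a hole on one side of a
  clique.\<close>

lemma conn_hole_diff_clq:
  assumes "hole H" "clq K"
  shows "conn (H - K)"
proof (cases "H \<inter> K = {}")
  case True
  obtain a xs where a: "hole_at a xs" "H = insert a (set xs)" using assms(1) unfolding hole_def by blast
  then have "xs \<noteq> []" unfolding hole_at_def by auto
  then have "hd xs \<in> set xs" by simp
  moreover have "adj (hd xs) a" using a(1) calculation adj_sym[of a "hd xs"] unfolding hole_at_def by blast
  moreover have "conn (set xs)" using a(1) conn_ipath unfolding hole_at_def by blast
  ultimately have "conn H" using conn_insert a(2) by blast
  then show ?thesis using True by (simp add: Diff_triv)
next
  case False
  then obtain a where aH: "a \<in> H" "a \<in> K" by blast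
  obtain xs where xs: "hole_at a xs" "H = insert a (set xs)" using assms(1) aH(1) by (rule hole_at_any)
  then obtain p r s ys where e: "xs = p # r # s # ys" unfolding hole_at_def
    by (metis Suc_le_length_iff numeral_3_eq_3)
  obtain zs q where zs: "xs = zs @ [q]" using e by (metis append_butlast_last_id list.distinct(1))
  have q: "last xs = q" using zs by simp
  have d: "ipath xs" "distinct xs" "a \<notin> set xs" using xs ipath_distinct unfolding hole_at_def by auto
  have a: "y = p \<or> y = q" if "y \<in> set xs" "adj a y" for y
    using xs(1) e q that unfolding hole_at_def by auto
  have K: "K \<inter> H \<subseteq> {a, p, q}"
  proof
    fix y assume y: "y \<in> K \<inter> H"
    show "y \<in> {a, p, q}"
    proof (cases "y = a")
      case False
      then have "adj a y" using clqD[OF assms(2) aH(2), of y] y by simp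
      then show ?thesis using a[of y] y xs(2) False by simp
    qed simp
  qed
  have "q \<in> set (s # ys)" using q e by (metis last_ConsR last_in_set list.distinct(1))
  then have "p \<noteq> q" "\<not> adj p q" using d e by auto
  then have "\<not> (p \<in> K \<and> q \<in> K)" using clqD[OF assms(2), of p q] by blast
  have HK: "H - K = H - (K \<inter> H)" by blast
  from \<open>\<not> (p \<in> K \<and> q \<in> K)\<close> consider "K \<inter> H = {a}" | "K \<inter> H = {a, p}" | "K \<inter> H = {a, q}"
    using K aH by blast
  then have "H - K \<in> {set xs, set (tl xs), set zs}"
  proof cases
    case 1
    have "H - {a} = set xs" using xs(2) d(3) by auto
    then show ?thesis using HK 1 by simp
  next
    case 2
    have "H - {a, p} = set (tl xs)" using xs(2) d e by auto
    then show ?thesis using HK 2 by simp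
  next
    case 3
    have "H - {a, q} = set zs" using xs(2) d zs by auto
    then show ?thesis using HK 3 by simp
  qed
  moreover have "ipath (tl xs)" using d(1) e by simp
  moreover have "ipath zs" using d(1) zs ipath_prefix by blast
  ultimately show ?thesis using conn_ipath[of xs] conn_ipath[of "tl xs"] conn_ipath[of zs] d(1) by auto
qed

text \<open>An induced path in \<open>S\<close> from \<open>p\<close> to \<open>q\<close> has an
  inner vertex, as its ends are not adjacent, and \<open>a\<close> sees only the ends; so
  \<open>a\<close> closes it to a hole.\<close>

lemma hole_through:
  assumes "conn S" "p \<in> S" "q \<in> S" "p \<noteq> q" "\<not> adj p q" "a \<notin> S"
    and "\<And>y. y \<in> S \<Longrightarrow> adj a y \<longleftrightarrow> y = p \<or> y = q"
  obtains H where "hole H" "{a, p, q} \<subseteq> H" "H \<subseteq> insert a S"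
proof -
  obtain xs where xs: "ipath xs" "xs \<noteq> []" "hd xs = p" "last xs = q" "set xs \<subseteq> S"
    using ipath_exists assms(1-3) by blast
  obtain ys where ys: "xs = p # ys" using xs(2,3) by (cases xs) auto
  have "ys \<noteq> []" using assms(4) xs(4) ys by auto
  moreover have "tl ys \<noteq> []"
  proof
    assume "tl ys = []"
    then have "ys = [q]" using xs(4) ys \<open>ys \<noteq> []\<close> by (cases ys) auto
    then show False using xs(1) ys assms(5) by simp
  qed
  ultimately have "length xs \<ge> 3" using ys by (cases ys; cases "tl ys") auto
  then have "hole_at a xs" using xs assms(6,7) unfolding hole_at_def by auto
  moreover have "p \<in> set xs" "q \<in> set xs" using xs by auto
  ultimately show ?thesis using that[of "insert a (set xs)"] xs(5) unfolding hole_def by blast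
qed

section \<open>Detours of a hole through an attached connected set\<close>

definition share_P3 :: "'a set \<Rightarrow> 'a set \<Rightarrow> bool" where
  "share_P3 H H' \<longleftrightarrow>
     (\<exists>p a q. p \<noteq> q \<and> adj p a \<and> adj a q \<and> {p, a, q} \<subseteq> H \<and> {p, a, q} \<subseteq> H')"

definition transversal :: "'a set \<Rightarrow> 'a set \<Rightarrow> bool" where
  "transversal V X \<longleftrightarrow> (\<forall>H. hole H \<longrightarrow> H \<subseteq> V \<longrightarrow> (\<exists>x. H \<inter> X = {x}))"

lemma transversal_meets:
  assumes "transversal V X" "hole H" "H \<subseteq> V"
  obtains x where "x \<in> H" "x \<in> X"
  using assms unfolding transversal_def by blast

lemma transversal_unique:
  assumes "transversal V X" "hole H" "H \<subseteq> V" "x \<in> H" "x \<in> X" "y \<in> H" "y \<in> X"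
  shows "x = y"
  using assms unfolding transversal_def by (metis IntI singletonD)

text \<open>\<open>P \<inter> H\<close> is closed in the connected set \<open>H - K\<close>, hence
  equal to it, so the rest of the hole would lie in the clique \<open>K\<close>.\<close>

lemma hole_part_clq_attached:
  assumes "hole H" "clq K" "P \<inter> K = {}" "att P \<inter> H \<subseteq> P \<union> K" "d \<in> P \<inter> H" "\<not> clq (H - P)"
  shows False
proof -
  have c: "conn (H - K)" using conn_hole_diff_clq assms(1,2) by simp
  have 1: "P \<inter> H \<subseteq> H - K" using assms(3) by blast
  have 2: "att (P \<inter> H) \<inter> (H - K) \<subseteq> P \<inter> H" using assms(4) unfolding att_def by blast
  have "P \<inter> H = H - K" by (rule connD[OF c 1 assms(5) 2])
  then have "H - P \<subseteq> K" by blast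
  then show False using assms(2,6) clq_subset by blast
qed

text \<open>Detour through \<open>D\<close> between two attachments, keeping the arc of the hole around the unattached vertex \<open>a\<close>.\<close>

lemma gap_hole_aux:
  assumes "hole_at a xs" "conn D" "D \<inter> insert a (set xs) = {}" "a \<notin> att D"
    and "xs = us @ x # vs @ z # ws" "x \<in> att D" "z \<in> att D" "\<not> adj x z"
  obtains H' where "hole H'" "H' \<subseteq> insert a (set xs) \<union> D" "H' \<inter> D \<noteq> {}"
    "{a, hd xs, last xs} \<subseteq> H'"
proof -
  have xs: "ipath xs" "a \<notin> set xs" "\<And>y. y \<in> set xs \<Longrightarrow> adj a y \<longleftrightarrow> y = hd xs \<or> y = last xs"
    using assms(1) unfolding hole_at_def by auto
  let ?L = "set (us @ [x])" and ?R = "set (z # ws)"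
  let ?S = "?L \<union> D \<union> ?R"
  have vs: "vs \<noteq> []"
  proof
    assume "vs = []"
    then have "ipath (x # z # ws)" using xs(1) assms(5) ipath_suffix[of us "x # z # ws"] by simp
    then show False using assms(8) by simp
  qed
  have gap: "x' \<noteq> y' \<and> \<not> adj x' y'" if "x' \<in> ?L" "y' \<in> ?R" for x' y'
    using ipath_gap[of "us @ [x]" vs "z # ws" x' y'] xs(1) vs that assms(5) by simp
  have "ipath (us @ [x])" using xs(1) assms(5) ipath_prefix[of "us @ [x]" "vs @ z # ws"] by simp
  then have cL: "conn ?L" by (rule conn_ipath)
  have "ipath (z # ws)" using xs(1) assms(5) ipath_suffix[of "us @ x # vs" "z # ws"] by simp
  then have cR: "conn ?R" by (rule conn_ipath)
  obtain d where d: "d \<in> D" "adj x d" using assms(6) adj_sym unfolding att_def by blast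
  obtain e where e: "e \<in> D" "adj e z" using assms(7) unfolding att_def by blast
  have "conn (?L \<union> D)" using conn_Un[OF cL assms(2), of x d] d by simp
  then have cS: "conn ?S" using conn_Un[OF _ cR, of "?L \<union> D" e z] e by simp
  have hd: "hd xs \<in> ?L" using assms(5) by (cases us) auto
  have "last xs = last (z # ws)" using assms(5) by (metis append_Cons append_is_Nil_conv last_append list.distinct(1) last_ConsR)
  then have la: "last xs \<in> ?R" by (metis last_in_set list.distinct(1))
  have ne: "hd xs \<noteq> last xs" "\<not> adj (hd xs) (last xs)" using gap[OF hd la] by auto
  have a: "a \<notin> ?S" using assms(3,5) xs(2) by auto
  have aD: "\<not> adj a y" if "y \<in> D" for y using assms(4) that adj_sym unfolding att_def by blast
  have adj: "adj a y \<longleftrightarrow> y = hd xs \<or> y = last xs" if "y \<in> ?S" for y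
  proof (cases "y \<in> D")
    case True
    then have "y \<notin> set xs" using assms(3) by blast
    moreover have "hd xs \<in> set xs" "last xs \<in> set xs" using hd la assms(5) by auto
    ultimately show ?thesis using aD True by blast
  next
    case False
    then have "y \<in> set xs" using that assms(5) by auto
    then show ?thesis by (rule xs(3))
  qed
  obtain H' where H': "hole H'" "{a, hd xs, last xs} \<subseteq> H'" "H' \<subseteq> insert a ?S"
    using hole_through[OF cS _ _ ne a adj] hd la by blast
  \<comment> \<open>Since \<open>vs\<close> is nonempty, no edge joins the two arcs. Without
    \<open>D\<close> the part of \<open>H'\<close> in the left arc would be closed in
    \<open>H' - {a}\<close> and could not reach \<open>last xs\<close>.\<close>
  have "H' \<inter> D \<noteq> {}"
  proof
    assume H'D: "H' \<inter> D = {}"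
    have "clq {a}" unfolding clq_def by simp
    then have c: "conn (H' - {a})" using conn_hole_diff_clq H'(1) by blast
    have 1: "H' \<inter> ?L \<subseteq> H' - {a}" using a by blast
    have 2: "hd xs \<in> H' \<inter> ?L" using H'(2) hd by blast
    have 3: "att (H' \<inter> ?L) \<inter> (H' - {a}) \<subseteq> H' \<inter> ?L"
    proof
      fix y assume y: "y \<in> att (H' \<inter> ?L) \<inter> (H' - {a})"
      then have "y \<notin> ?R" using gap unfolding att_def by blast
      then show "y \<in> H' \<inter> ?L" using y H'(3) H'D by blast
    qed
    have "H' \<inter> ?L = H' - {a}" by (rule connD[OF c 1 2 3])
    then have "last xs \<in> ?L" using H'(2) la a by blast
    then show False using gap la by blast
  qed
  moreover have "H' \<subseteq> insert a (set xs) \<union> D" using H'(3) assms(5) by auto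
  ultimately show ?thesis using that H' by blast
qed

lemma gap_hole:
  assumes "hole H" "a \<in> H" "conn D" "D \<inter> H = {}" "a \<notin> att D" "\<not> clq (att D \<inter> H)"
  obtains H' where "hole H'" "H' \<subseteq> H \<union> D" "H' \<inter> D \<noteq> {}" "a \<in> H'" "share_P3 H H'"
proof -
  obtain xs where xs: "hole_at a xs" "H = insert a (set xs)" using assms(1,2) by (rule hole_at_any)
  obtain x z where xz: "x \<in> att D \<inter> H" "z \<in> att D \<inter> H" "x \<noteq> z" "\<not> adj x z"
    using assms(6) by (rule not_clqE)
  then have att: "x \<in> att D" "z \<in> att D" and xz': "\<not> adj z x"
    using adj_sym[of z x] by auto
  have "x \<in> set xs" "z \<in> set xs" using xz assms(5) xs(2) by auto
  then obtain us vs where s: "xs = us @ x # vs" by (meson split_list)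
  have D: "D \<inter> insert a (set xs) = {}" using assms(4) xs(2) by simp
  have ex: "\<exists>H'. hole H' \<and> H' \<subseteq> insert a (set xs) \<union> D \<and> H' \<inter> D \<noteq> {} \<and> {a, hd xs, last xs} \<subseteq> H'"
  proof (cases "z \<in> set vs")
    case True
    then obtain vs' ws where "vs = vs' @ z # ws" by (meson split_list)
    then have "xs = us @ x # vs' @ z # ws" using s by simp
    from gap_hole_aux[OF xs(1) assms(3) D assms(5) this att xz(4)] show ?thesis by metis
  next
    case False
    then have "z \<in> set us" using s \<open>z \<in> set xs\<close> xz(3) by auto
    then obtain us' ws where "us = us' @ z # ws" by (meson split_list)
    then have "xs = us' @ z # ws @ x # vs" using s by simp
    from gap_hole_aux[OF xs(1) assms(3) D assms(5) this att(2,1) xz'] show ?thesis by metis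
  qed
  then obtain H' where H': "hole H'" "H' \<subseteq> insert a (set xs) \<union> D" "H' \<inter> D \<noteq> {}" "{a, hd xs, last xs} \<subseteq> H'"
    by blast
  have ne: "xs \<noteq> []" "length xs \<ge> 3" using xs(1) unfolding hole_at_def by auto
  then have "hd xs \<in> set xs" "last xs \<in> set xs" by auto
  moreover have "hd xs \<noteq> last xs"
    using xs(1) ne ipath_distinct[of xs] unfolding hole_at_def
    by (cases xs) (auto split: if_splits)
  moreover have "adj (hd xs) a" "adj a (last xs)"
    using xs(1) calculation(1,2) adj_sym unfolding hole_at_def by blast+
  ultimately have "share_P3 H H'" using H'(4) xs(2) unfolding share_P3_def by blast
  then show ?thesis using that H' xs(2) by blast
qed

lemma hole_4:
  assumes "adj a b" "adj b c" "adj c d" "adj d a" "\<not> adj a c" "\<not> adj b d" "a \<noteq> c" "b \<noteq> d"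
  shows "hole {a, b, c, d}"
proof -
  have "a \<noteq> b" "b \<noteq> c" "c \<noteq> d" "d \<noteq> a" using assms adj_irrefl by blast+
  moreover have "adj a d" using assms adj_sym by blast
  ultimately have "hole_at a [b, c, d]" using assms unfolding hole_at_def by auto
  then show ?thesis unfolding hole_def by (intro exI[of _ a] exI[of _ "[b, c, d]"]) auto
qed

text \<open>Otherwise any nonadjacent pair of \<open>H\<close> forms a 4-hole with \<open>w\<close>
  and \<open>w'\<close>. The two neighbours of the transversal vertex \<open>h\<close> of
  \<open>H\<close> give such a hole, which forces \<open>w\<close> or \<open>w'\<close> into
  \<open>X\<close>; pairing \<open>h\<close> with a nonneighbour on \<open>H\<close> then gives a
  hole with two vertices of \<open>X\<close>.\<close>

lemma hubs_adjacent:
  assumes "transversal V X" "hole H" "H \<subseteq> V" "w \<in> V" "w' \<in> V" "w \<noteq> w'"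
    and "\<And>h. h \<in> H \<Longrightarrow> adj w h" "\<And>h. h \<in> H \<Longrightarrow> adj w' h"
  shows "adj w w'"
proof (rule ccontr)
  assume nw: "\<not> adj w w'"
  obtain h where h: "H \<inter> X = {h}" using assms(1-3) unfolding transversal_def by blast
  then have hH: "h \<in> H" "h \<in> X" by auto
  obtain p q r where pqr: "p \<in> H" "q \<in> H" "r \<in> H" "p \<noteq> q" "\<not> adj p q" "adj h p" "adj h q"
    "r \<noteq> h" "\<not> adj h r"
    using assms(2) hH(1) by (rule hole_nbrs)
  have wH: "w \<notin> H" "w' \<notin> H" using assms(7,8) adj_irrefl by blast+
  have hole: "hole {w, y, w', z}" if "y \<in> H" "z \<in> H" "y \<noteq> z" "\<not> adj y z" for y z
    using hole_4[of w y w' z] that assms(6-8) adj_sym nw by blast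
  have "p \<noteq> h" "q \<noteq> h" using pqr adj_irrefl by blast+
  then have "p \<notin> X" "q \<notin> X" using h pqr by blast+
  moreover have "hole {w, p, w', q}" "{w, p, w', q} \<subseteq> V" using hole[of p q] pqr assms(3-5) by auto
  then obtain x where "x \<in> {w, p, w', q}" "x \<in> X" by (rule transversal_meets[OF assms(1)])
  ultimately obtain x where x: "x = w \<or> x = w'" "x \<in> X" by blast
  have "hole {w, h, w', r}" "{w, h, w', r} \<subseteq> V" using hole[of h r] pqr hH assms(3-5) by auto
  from transversal_unique[OF assms(1) this, of x h] have "x = h" using x hH by blast
  then show False using x(1) hH wH by blast
qed

text \<open>The three holes of a prism cover every vertex an even number of times, so they cannot all meet
  the transversal exactly once.\<close>

lemma no_prism:
  assumes "transversal V X" "hole H" "H \<subseteq> V" "H \<inter> X = {h}"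
    and "ipath ds" "length ds \<ge> 2" "set ds \<subseteq> V" "set ds \<inter> H = {}"
    and "clq (att (set (butlast ds)) \<inter> H)" "clq (att (set (tl ds)) \<inter> H)"
    and "H \<subseteq> att (set ds)" "h \<in> att (set (butlast ds))"
  shows False
proof -
  let ?A1 = "att (set (butlast ds)) \<inter> H" and ?A2 = "att (set (tl ds)) \<inter> H"
  obtain d1 ds' where ds1: "ds = d1 # ds'" "ds' \<noteq> []" using assms(6) by (cases ds; cases "tl ds") auto
  obtain es d2 where ds2: "ds' = es @ [d2]" using ds1(2) by (metis append_butlast_last_id)
  have ds: "ds = d1 # es @ [d2]" "butlast ds = d1 # es" "tl ds = es @ [d2]"
    using ds1 ds2 by (auto simp: butlast_append)
  have un: "H \<subseteq> ?A1 \<union> ?A2" using assms(11) unfolding ds att_def by auto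
  have hH: "h \<in> H" "h \<in> X" "h \<in> ?A1" using assms(4,12) by auto
  obtain zs where zs: "hole_at h zs" "H = insert h (set zs)" using assms(2) hH(1) by (rule hole_at_any)
  have zs3: "length zs \<ge> 3" "zs \<noteq> []" using zs(1) unfolding hole_at_def by auto
  have ends: "hd zs \<noteq> last zs \<and> \<not> adj (hd zs) (last zs)"
  proof -
    obtain p r s ys where e: "zs = p # r # s # ys" using zs3
      by (metis Suc_le_length_iff numeral_3_eq_3)
    then have "last zs \<in> set (s # ys)" by (metis last_ConsR last_in_set list.distinct(1))
    then show ?thesis using ipath_gap[of "[p]" "[r]" "s # ys" p "last zs"] zs(1) e
      unfolding hole_at_def by simp
  qed
  have in_zs: "hd zs \<in> H" "last zs \<in> H" using zs(2) zs3 by auto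
  \<comment> \<open>The two neighbours of \<open>h\<close> on \<open>H\<close> are not adjacent, so
    they are not both in the clique \<open>?A2\<close>. Reversing the list makes a neighbour in
    \<open>?A1\<close> its head.\<close>
  have "hd zs \<in> ?A1 \<or> last zs \<in> ?A1"
    using un in_zs ends assms(10) unfolding clq_def by blast
  then obtain xs where xs: "hole_at h xs" "H = insert h (set xs)" "hd xs \<in> ?A1"
    "hd xs \<noteq> last xs" "\<not> adj (hd xs) (last xs)"
  proof
    assume "hd zs \<in> ?A1" then show ?thesis using that[of zs] zs ends by blast
  next
    assume "last zs \<in> ?A1"
    then show ?thesis using that[of "rev zs"] zs ends zs3 hole_at_rev[of h zs] adj_commute[of "hd zs"]
      by (auto simp: hd_rev last_rev)
  qed
  have xs3: "length xs \<ge> 3" "ipath xs" "h \<notin> set xs"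
    and hadj: "\<And>y. y \<in> set xs \<Longrightarrow> adj h y \<longleftrightarrow> y = hd xs \<or> y = last xs"
    using xs(1) unfolding hole_at_def by auto
  obtain p ys where ys: "xs = p # ys" "ys \<noteq> []" using xs3(1) by (cases xs; cases "tl xs") auto
  have l: "last xs \<in> set ys" using ys by auto
  have pys: "p \<notin> set ys" using xs3(2) ys by auto
  have ysA2: "y \<in> ?A2 \<and> y \<notin> ?A1" if "y \<in> set ys" for y
  proof -
    have y: "y \<in> set xs" "y \<in> H" "y \<noteq> p" "y \<noteq> h" using that ys xs(2) pys xs3(3) by auto
    have "y \<notin> ?A1"
    proof
      assume yA: "y \<in> ?A1"
      then have "adj h y" "adj p y" using hH(3) xs(3) ys(1) y assms(9) unfolding clq_def by auto
      then show False using hadj[OF y(1)] xs(5) y ys(1) by auto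
    qed
    then show ?thesis using un y by blast
  qed
  \<comment> \<open>The induced path \<open>ys\<close> lies in the clique \<open>?A2\<close>, so it
    has at most two vertices and \<open>H\<close> is a 4-hole.\<close>
  have "tl (tl ys) = []"
  proof (rule ccontr)
    assume "tl (tl ys) \<noteq> []"
    then obtain o1 o2 o3 ws where e: "ys = [o1] @ [o2] @ (o3 # ws)" by (cases ys; cases "tl ys"; cases "tl (tl ys)") auto
    moreover have "ipath ys" using xs3(2) ys(1) by simp
    ultimately have "o1 \<noteq> o3" "\<not> adj o1 o3" by auto
    then show False using ysA2[of o1] ysA2[of o3] e clqD[OF assms(10), of o1 o3] by simp
  qed
  then obtain r q where rq: "ys = [r, q]" using xs3(1) ys by (cases ys; cases "tl ys") auto
  have H: "H = {h, p, r, q}" using xs(2) ys rq by auto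
  have hp: "hd xs = p" "last xs = q" using ys rq by auto
  have nh: "h \<noteq> p" "h \<noteq> r" "h \<noteq> q" "\<not> adj h r" "adj h p" "adj h q" "p \<noteq> r" "p \<noteq> q" "r \<noteq> q"
    "adj p r" "adj r q" "\<not> adj p q"
    using xs3(2,3) ys rq hadj by auto
  have A2: "h \<notin> ?A2" using ysA2[of r] rq nh clqD[OF assms(10), of h r] by auto
  have pA2: "p \<notin> ?A2" using ysA2[of q] rq nh clqD[OF assms(10), of p q] by auto
  have A1: "h \<in> ?A1" "p \<in> ?A1" "r \<notin> ?A1" "q \<notin> ?A1" using hH(3) xs(3) hp ysA2 rq by auto
  have rqA2: "r \<in> ?A2" "q \<in> ?A2" using ysA2 rq by auto
  have nb1: "adj d v \<longleftrightarrow> d = d1" if "d \<in> set ds" "v = h \<or> v = p" for d v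
  proof -
    have v: "v \<in> ?A1" "v \<notin> ?A2" "v \<in> H" using that(2) A1 A2 pA2 by auto
    have no: "\<not> adj d' v" if "d' \<in> set (tl ds)" for d' using v(2,3) that unfolding att_def by blast
    obtain d' where d': "d' \<in> set (butlast ds)" "adj d' v" using v(1) unfolding att_def by blast
    then have "d' = d1" using no[of d'] ds(2,3) by auto
    then show ?thesis using no[of d] d'(2) that(1) ds1(1) ds(3) ds2 by auto
  qed
  have nb2: "adj d v \<longleftrightarrow> d = d2" if "d \<in> set ds" "v = r \<or> v = q" for d v
  proof -
    have v: "v \<in> ?A2" "v \<notin> ?A1" "v \<in> H" using that(2) A1 rqA2 by auto
    have no: "\<not> adj d' v" if "d' \<in> set (butlast ds)" for d' using v(2,3) that unfolding att_def by blast
    obtain d' where d': "d' \<in> set (tl ds)" "adj d' v" using v(1) unfolding att_def by blast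
    then have "d' = d2" using no[of d'] ds(2,3) by auto
    then show ?thesis using no[of d] d'(2) that(1) ds1(1) ds(2) ds2 by auto
  qed
  have long: "length (ds @ [v]) \<ge> 3" "last ds = d2" "hd ds = d1" for v using assms(6) ds by auto
  have ip: "ipath (ds @ [v])" if "v = r \<or> v = q" for v
  proof -
    have "v \<notin> set ds" using assms(8) H that by auto
    then show ?thesis using assms(5) nb2 that long(2) unfolding ipath_snoc by auto
  qed
  have h1: "hole_at v (ds @ [v'])" if "v = h \<and> v' = q \<or> v = p \<and> v' = r" for v v'
  proof -
    have vv: "v \<noteq> v'" "adj v v'" "v \<in> H" "v' \<in> H" using that nh H by auto
    have "ipath (ds @ [v'])" using ip that by blast
    moreover have "v \<notin> set (ds @ [v'])" using vv assms(8) by auto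
    moreover have "\<forall>y\<in>set (ds @ [v']). adj v y \<longleftrightarrow> y = hd (ds @ [v']) \<or> y = last (ds @ [v'])"
    proof
      fix y assume y: "y \<in> set (ds @ [v'])"
      have hd: "hd (ds @ [v']) = d1" "last (ds @ [v']) = v'" using ds by auto
      show "adj v y \<longleftrightarrow> y = hd (ds @ [v']) \<or> y = last (ds @ [v'])"
      proof (cases "y = v'")
        case True then show ?thesis using vv hd by auto
      next
        case False
        then have "y \<in> set ds" using y by auto
        then show ?thesis using nb1[of y v] that False hd adj_commute[of v y] by auto
      qed
    qed
    ultimately show ?thesis using long(1) unfolding hole_at_def by blast
  qed
  have "hole (insert p (set (ds @ [r])))" "hole (insert h (set (ds @ [q])))"
    using h1 unfolding hole_def by blast+
  moreover have "insert p (set (ds @ [r])) \<subseteq> V" "insert h (set (ds @ [q])) \<subseteq> V"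
    using assms(3,7) H by auto
  note holes = calculation this
  \<comment> \<open>The hole through \<open>p\<close> and \<open>r\<close> can be hit only inside
    \<open>ds\<close>; the hole through \<open>h\<close> and \<open>q\<close> then contains both
    that vertex and \<open>h\<close>.\<close>
  have "p \<notin> X" "r \<notin> X" using assms(4) H nh by auto
  moreover obtain x where "x \<in> insert p (set (ds @ [r]))" "x \<in> X"
    using holes(1,3) by (rule transversal_meets[OF assms(1)])
  ultimately have xds: "x \<in> set ds" "x \<in> X" by auto
  then have "x = h" using transversal_unique[OF assms(1) holes(2,4), of x h] hH by simp
  then show False using xds assms(8) hH by blast
qed

text \<open>Take a shortest induced path in \<open>D\<close> whose attachments on \<open>H\<close>
  are not a clique. If some vertex of \<open>H\<close> is unattached, \<open>gap_hole\<close> at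
  that vertex gives the second alternative. Otherwise the path sees all of \<open>H\<close> while
  its proper connected parts attach to cliques: a single vertex is a hub, and a longer path is
  excluded as a prism.\<close>

lemma attached_hole:
  assumes "transversal V X" "hole H" "H \<subseteq> V" "conn D" "D \<subseteq> V" "D \<inter> H = {}" "\<not> clq (att D \<inter> H)"
  obtains (hub) d where "d \<in> D" "\<And>h. h \<in> H \<Longrightarrow> adj d h"
  | (hole) H' where "hole H'" "H' \<subseteq> H \<union> D" "H' \<inter> D \<noteq> {}" "share_P3 H H'"
proof (cases "\<exists>d\<in>D. \<forall>h\<in>H. adj d h")
  case True then show ?thesis using hub by blast
next
  case nohub: False
  show ?thesis
  proof (rule ccontr)
    assume nt: "\<not> thesis"
    define R where "R ds \<longleftrightarrow> ipath ds \<and> ds \<noteq> [] \<and> set ds \<subseteq> D \<and> \<not> clq (att (set ds) \<inter> H)" for ds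
    have ext: "\<exists>ds. R ds \<and> set ds \<subseteq> P" if P: "conn P" "P \<subseteq> D" "\<not> clq (att P \<inter> H)" for P
    proof -
      obtain x z where xz: "x \<in> att P \<inter> H" "z \<in> att P \<inter> H" "x \<noteq> z" "\<not> adj x z"
        using P(3) by (rule not_clqE)
      then obtain d e where de: "d \<in> P" "adj d x" "e \<in> P" "adj e z" unfolding att_def by blast
      obtain ds where ds: "ipath ds" "ds \<noteq> []" "hd ds = d" "last ds = e" "set ds \<subseteq> P"
        using ipath_exists[OF P(1) de(1,3)] by blast
      then have "d \<in> set ds" "e \<in> set ds" by auto
      then have "x \<in> att (set ds)" "z \<in> att (set ds)" using de unfolding att_def by blast+
      then have "\<not> clq (att (set ds) \<inter> H)" using xz unfolding clq_def by blast
      then show ?thesis using ds P(2) unfolding R_def by blast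
    qed
    obtain ds0 where "R ds0" using ext[OF assms(4) _ assms(7)] by blast
    then obtain ds where ds: "R ds" and min: "\<And>es. R es \<Longrightarrow> length ds \<le> length es"
      using ex_has_least_nat[of R ds0 length] by blast
    have dsD: "ipath ds" "ds \<noteq> []" "set ds \<subseteq> D" "\<not> clq (att (set ds) \<inter> H)"
      using ds unfolding R_def by auto
    have cds: "conn (set ds)" using dsD(1) by (rule conn_ipath)
    have dis: "set ds \<inter> H = {}" using dsD(3) assms(6) by blast
    have full: "H \<subseteq> att (set ds)"
    proof
      fix a assume a: "a \<in> H"
      show "a \<in> att (set ds)"
      proof (rule ccontr)
        assume na: "a \<notin> att (set ds)"
        obtain H' where H': "hole H'" "H' \<subseteq> H \<union> set ds" "H' \<inter> set ds \<noteq> {}" "a \<in> H'" "share_P3 H H'"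
          by (rule gap_hole[OF assms(2) a cds dis na dsD(4)])
        have "H' \<subseteq> H \<union> D" "H' \<inter> D \<noteq> {}" using H'(2,3) dsD(3) by blast+
        then show False using nt hole[OF H'(1) _ _ H'(5)] by simp
      qed
    qed
    have small: "clq (att P \<inter> H)" if P: "conn P" "P \<subset> set ds" for P
    proof (rule ccontr)
      assume "\<not> clq (att P \<inter> H)"
      then obtain es where es: "R es" "set es \<subseteq> P" using ext[OF P(1)] P(2) dsD(3) by blast
      have "length es = card (set es)" using es(1) ipath_distinct distinct_card unfolding R_def by metis
      also have "\<dots> < card (set ds)" using es(2) P(2) by (intro psubset_card_mono) auto
      also have "\<dots> \<le> length ds" by (rule card_length)
      finally show False using min[OF es(1)] by simp
    qed
    have len: "length ds \<ge> 2"
    proof (rule ccontr)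
      assume "\<not> length ds \<ge> 2"
      then obtain d where "ds = [d]" using dsD(2) by (cases ds; cases "tl ds") auto
      then have "\<forall>h\<in>H. adj d h" "d \<in> D" using full dsD(3) unfolding att_def by auto
      then show False using nohub by blast
    qed
    obtain d ds' where e1: "ds = d # ds'" using dsD(2) by (cases ds) auto
    obtain es e where e2: "ds = es @ [e]" using dsD(2) by (metis append_butlast_last_id)
    have dist: "distinct ds" using dsD(1) by (rule ipath_distinct)
    have "conn (set (tl ds))" using conn_ipath[of ds'] dsD(1) e1 by simp
    then have c2: "clq (att (set (tl ds)) \<inter> H)" using small dist e1 by auto
    have "conn (set (butlast ds))" using conn_ipath[of es] ipath_prefix[of es "[e]"] dsD(1) e2 by simp
    then have c1: "clq (att (set (butlast ds)) \<inter> H)" using small dist e2 by auto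
    obtain h where h: "H \<inter> X = {h}" using assms(1-3) unfolding transversal_def by blast
    have dV: "set ds \<subseteq> V" using dsD(3) assms(5) by blast
    show False
    proof (cases "h \<in> att (set (butlast ds))")
      case True
      show ?thesis by (rule no_prism[OF assms(1-3) h dsD(1) len dV dis c1 c2 full True])
    next
      case False
      \<comment> \<open>Reversing the path moves the attachment of \<open>h\<close> to the initial
        part, as \<open>no_prism\<close> requires.\<close>
      have s: "set (butlast (rev ds)) = set (tl ds)" "set (tl (rev ds)) = set (butlast ds)"
        by (simp_all add: butlast_rev e2)
      have "h \<in> att (set ds)" using full h by blast
      then have "adj e h" using False e2 unfolding att_def by auto
      moreover have "e \<in> set (tl ds)" using e1 e2 len by (cases es) auto
      ultimately have hb: "h \<in> att (set (butlast (rev ds)))" unfolding s att_def by blast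
      show ?thesis
        using no_prism[OF assms(1-3) h ipath_rev[OF dsD(1)], unfolded s] len dV dis c1 c2 full hb[unfolded s] by simp
    qed
  qed
qed

section \<open>Atoms with the NC property\<close>

lemma attI: "d \<in> D \<Longrightarrow> adj d x \<Longrightarrow> x \<in> att D"
  unfolding att_def by blast

lemma attE:
  assumes "x \<in> att D"
  obtains d where "d \<in> D" "adj d x"
  using assms unfolding att_def by blast

lemma att_mono: "D \<subseteq> D' \<Longrightarrow> att D \<subseteq> att D'"
  unfolding att_def by blast

lemma att_Un: "att (D \<union> D') = att D \<union> att D'"
  unfolding att_def by blast

text \<open>The ends of the common path are the two neighbours of its middle vertex on the hole
  \<open>H\<close>, hence not adjacent.\<close>

lemma share_P3_not_clq:
  assumes "hole H" "share_P3 H H'" "H \<inter> H' \<subseteq> S"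
  shows "\<not> clq S"
proof
  assume S: "clq S"
  obtain p a q where pq: "p \<noteq> q" "adj p a" "adj a q" "{p, a, q} \<subseteq> H" "{p, a, q} \<subseteq> H'"
    using assms(2) unfolding share_P3_def by auto
  have a: "a \<in> H" using pq(4) by simp
  obtain xs where xs: "hole_at a xs" "H = insert a (set xs)" using assms(1) a by (rule hole_at_any)
  have "p \<noteq> a" "q \<noteq> a" using pq(2,3) adj_irrefl by auto
  then have pqx: "p \<in> set xs" "q \<in> set xs" using pq(4) xs(2) by auto
  have ax: "\<And>y. y \<in> set xs \<Longrightarrow> adj a y \<longleftrightarrow> y = hd xs \<or> y = last xs" and ip: "ipath xs" "length xs \<ge> 3"
    using xs(1) unfolding hole_at_def by auto
  obtain x r s ys where e: "xs = x # r # s # ys" using ip(2)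
    by (metis Suc_le_length_iff numeral_3_eq_3)
  then have "last xs \<in> set (s # ys)" by (metis last_ConsR last_in_set list.distinct(1))
  then have no: "\<not> adj (hd xs) (last xs)" using ipath_gap[of "[x]" "[r]" "s # ys" x "last xs"] ip(1) e by simp
  have "p = hd xs \<or> p = last xs" "q = hd xs \<or> q = last xs"
    using ax[OF pqx(1)] ax[OF pqx(2)] pq(2,3) adj_sym[of p a] by auto
  then have "\<not> adj p q" using no pq(1) adj_sym[of p q] by metis
  moreover have "p \<in> S" "q \<in> S" using assms(3) pq(4,5) by auto
  ultimately show False using clqD[OF S, of p q] pq(1) by blast
qed

text \<open>Only the arc through \<open>C\<close> is chosen explicitly. With \<open>r\<close> the
  successor of \<open>a\<close> on it, \<open>hole_through\<close> at \<open>r\<close> closes the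
  hole, and \<open>b\<close> must be on it because nothing else links the rest of that arc to
  \<open>C'\<close> or to \<open>a\<close>.\<close>

lemma two_sided_hole:
  assumes "conn C" "conn C'" "C \<inter> C' = {}" "att C \<inter> C' = {}"
    and "a \<in> att C" "b \<in> att C" "a \<in> att C'" "b \<in> att C'" "a \<notin> C \<union> C'" "b \<notin> C \<union> C'"
    and "a \<noteq> b" "\<not> adj a b"
  obtains H where "hole H" "H \<subseteq> C \<union> C' \<union> {a, b}" "a \<in> H" "b \<in> H" "H \<inter> C \<noteq> {}"
proof -
  obtain ca where ca: "ca \<in> C" "adj ca a" using assms(5) by (rule attE)
  obtain cb where cb: "cb \<in> C" "adj cb b" using assms(6) by (rule attE)
  obtain ea where ea: "ea \<in> C'" "adj ea a" using assms(7) by (rule attE)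
  obtain eb where eb: "eb \<in> C'" "adj eb b" using assms(8) by (rule attE)
  have "conn (insert a C)" using conn_insert[OF assms(1) ca] .
  then have "conn (insert b (insert a C))" using conn_insert[of "insert a C" cb b] cb by simp
  then obtain xs where xs: "ipath xs" "xs \<noteq> []" "hd xs = a" "last xs = b" "set xs \<subseteq> insert b (insert a C)"
    by (rule ipath_exists[of _ a b]) auto
  obtain zs where zs: "xs = a # zs" using xs(2,3) by (cases xs) auto
  have "zs \<noteq> []" using xs(4) zs assms(11) by auto
  then obtain r ys where ry: "zs = r # ys" by (cases zs) auto
  have "ys \<noteq> []"
  proof
    assume "ys = []"
    then have "xs = [a, b]" using xs(4) zs ry by simp
    then show False using xs(1) assms(12) by simp
  qed
  then have lb: "last ys = b" "b \<in> set ys" "hd ys \<in> set ys" using xs(4) zs ry by auto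
  have ip: "ipath ys" "a \<notin> set ys" "r \<notin> set ys" "r \<noteq> a" "adj a r"
    and ay: "\<And>y. y \<in> set ys \<Longrightarrow> \<not> adj a y"
    and ry': "\<And>y. y \<in> set ys \<Longrightarrow> adj r y \<longleftrightarrow> y = hd ys"
    using xs(1) zs ry by auto
  have rC: "r \<in> C" using xs(5) zs ry ip lb by auto
  have ysC: "set ys \<subseteq> insert b C" using xs(5) zs ry ip by auto
  have noedge: "\<not> adj c e" if "c \<in> C" "e \<in> C'" for c e
    using attI[OF that(1), of e] that(2) assms(4) by blast
  let ?S = "insert a C' \<union> set ys"
  have c1: "conn (insert a C')" using conn_insert[OF assms(2) ea] .
  have cS: "conn ?S"
    by (rule conn_Un[OF c1 conn_ipath[OF ip(1)], of eb b]) (use eb lb in auto)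
  have rS: "r \<notin> ?S" using rC assms(3) ip by auto
  have adj: "adj r y \<longleftrightarrow> y = a \<or> y = hd ys" if "y \<in> ?S" for y
  proof -
    consider "y = a" | "y \<in> C'" | "y \<in> set ys" using \<open>y \<in> ?S\<close> by blast
    then show ?thesis
    proof cases
      case 1 then show ?thesis using ip(5) adj_sym by simp
    next
      case 2
      then have "y \<noteq> a" "y \<notin> set ys" using assms(3,9,10) ysC by auto
      then show ?thesis using noedge[OF rC 2] lb(3) by auto
    next
      case 3 then show ?thesis using ry'[OF 3] ip(2) by auto
    qed
  qed
  have 1: "a \<in> ?S" "hd ys \<in> ?S" "a \<noteq> hd ys" "\<not> adj a (hd ys)" using lb(3) ip(2) ay by auto
  obtain H where H: "hole H" "{r, a, hd ys} \<subseteq> H" "H \<subseteq> insert r ?S"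
    by (rule hole_through[OF cS 1 rS adj])
  have "b \<in> H"
  proof (rule ccontr)
    assume bH: "b \<notin> H"
    have "clq {r}" unfolding clq_def by simp
    then have c: "conn (H - {r})" using conn_hole_diff_clq H(1) by simp
    have t1: "H \<inter> set ys \<subseteq> H - {r}" using ip(3) by auto
    have t2: "hd ys \<in> H \<inter> set ys" using H(2) lb(3) by simp
    have t3: "att (H \<inter> set ys) \<inter> (H - {r}) \<subseteq> H \<inter> set ys"
    proof
      fix y assume y: "y \<in> att (H \<inter> set ys) \<inter> (H - {r})"
      then have "y \<in> att (H \<inter> set ys)" by simp
      then obtain t where t: "t \<in> H \<inter> set ys" "adj t y" by (rule attE)
      have tC: "t \<in> C" using t(1) ysC bH by auto
      have "y \<notin> C'" using noedge[OF tC] t(2) by blast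
      moreover have "y \<noteq> a" using ay[of t] t adj_sym by auto
      ultimately show "y \<in> H \<inter> set ys" using y H(3) by auto
    qed
    have "H \<inter> set ys = H - {r}" by (rule connD[OF c t1 t2 t3])
    moreover have "a \<in> H - {r}" using H(2) ip(4) by simp
    ultimately show False using ip(2) by blast
  qed
  moreover have "H \<subseteq> C \<union> C' \<union> {a, b}" using H(3) ysC rC by auto
  moreover have "a \<in> H" "r \<in> H \<inter> C" using H(2) rC by auto
  ultimately show ?thesis using that[OF H(1)] by blast
qed

text \<open>\<open>B\<close> has the fewest vertices among the sets that contain a hole and have
  clique attachments from outside; \<open>V\<close> itself is one of them. If \<open>K\<close> were
  a clique cutset of \<open>B\<close>, then \<open>K\<close> together with the component holding the
  rest of the hole would be a smaller such set.\<close>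

lemma atom_with_clq_attachments:
  assumes "finite V" "hole H0" "H0 \<subseteq> V"
  obtains B H where "B \<subseteq> V" "hole H" "H \<subseteq> B" "atom B"
    "\<And>D. conn D \<Longrightarrow> D \<subseteq> V - B \<Longrightarrow> clq (att D \<inter> B)"
proof -
  define good where "good B \<longleftrightarrow> B \<subseteq> V \<and> (\<exists>H\<subseteq>B. hole H) \<and>
    (\<forall>D. conn D \<longrightarrow> D \<subseteq> V - B \<longrightarrow> clq (att D \<inter> B))" for B
  have "good V"
    using assms(2,3) unfolding good_def att_def clq_def by auto
  then obtain B where B: "good B" and min: "\<And>B'. good B' \<Longrightarrow> card B \<le> card B'"
    using ex_has_least_nat[of good V card] by blast
  obtain H where H: "hole H" "H \<subseteq> B" using B unfolding good_def by blast
  have BV: "B \<subseteq> V" and Bc: "\<And>D. conn D \<Longrightarrow> D \<subseteq> V - B \<Longrightarrow> clq (att D \<inter> B)"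
    using B unfolding good_def by auto
  have finB: "finite B" using BV assms(1) finite_subset by blast
  have "atom B"
    unfolding atom_def
  proof (intro allI impI)
    fix K assume K: "K \<subseteq> B" "clq K"
    have "H - K \<noteq> {}"
    proof
      assume "H - K = {}"
      then have "H \<subseteq> K" by blast
      then show False using K(2) H(1) hole_not_clq clq_subset by blast
    qed
    then obtain h where h: "h \<in> H - K" by blast
    then have "h \<in> B - K" using H(2) by blast
    then obtain B1 where B1: "h \<in> B1" "B1 \<subseteq> B - K" "conn B1" "att B1 \<inter> (B - K) \<subseteq> B1"
      by (rule component_exists)
    have HB1: "H - K \<subseteq> B1"
    proof -
      have c: "conn (H - K)" using conn_hole_diff_clq[OF H(1) K(2)] .
      have 1: "B1 \<inter> (H - K) \<subseteq> H - K" by blast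
      have 2: "h \<in> B1 \<inter> (H - K)" using h B1(1) by blast
      have 3: "att (B1 \<inter> (H - K)) \<inter> (H - K) \<subseteq> B1 \<inter> (H - K)"
        using B1(4) H(2) att_mono[of "B1 \<inter> (H - K)" B1] by blast
      have "B1 \<inter> (H - K) = H - K" by (rule connD[OF c 1 2 3])
      then show ?thesis by blast
    qed
    define B' where "B' = K \<union> B1"
    have B'B: "B' \<subseteq> B" unfolding B'_def using K(1) B1(2) by blast
    have "clq (att D \<inter> B')" if D: "conn D" "D \<subseteq> V - B'" for D
    proof (cases "D \<inter> B = {}")
      case True
      then have "clq (att D \<inter> B)" using Bc D BV by blast
      then show ?thesis by (rule clq_subset) (use B'B in blast)
    next
      case False
      \<comment> \<open>Suppose \<open>D\<close> attaches to \<open>x\<close> in \<open>B1\<close>.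
        The component \<open>P\<close> of \<open>D - B\<close> responsible for this also attaches to
        some \<open>y\<close> in \<open>D \<inter> B\<close>. Attachments of \<open>P\<close> form a
        clique, so \<open>x\<close> and \<open>y\<close> are adjacent and \<open>y\<close> would
        belong to \<open>B1\<close>.\<close>
      have "att D \<inter> B1 = {}"
      proof (rule ccontr)
        assume "att D \<inter> B1 \<noteq> {}"
        then obtain x where x: "x \<in> B1" "x \<in> att D" by blast
        obtain d where d: "d \<in> D" "adj d x" using x(2) by (rule attE)
        have dB: "d \<notin> B"
        proof
          assume "d \<in> B"
          then have "d \<in> B - K" using d(1) D(2) unfolding B'_def by blast
          moreover have "d \<in> att B1" using attI[OF x(1)] d(2) adj_sym by blast
          ultimately have "d \<in> B1" using B1(4) by blast
          then show False using d(1) D(2) unfolding B'_def by blast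
        qed
        then have "d \<in> D - B" using d(1) by blast
        then obtain P where P: "d \<in> P" "P \<subseteq> D - B" "conn P" "att P \<inter> (D - B) \<subseteq> P"
          by (rule component_exists)
        have "\<exists>y. y \<in> att P \<and> y \<in> D \<inter> B"
        proof (rule ccontr)
          assume no: "\<nexists>y. y \<in> att P \<and> y \<in> D \<inter> B"
          have 1: "P \<subseteq> D" using P(2) by blast
          have 2: "att P \<inter> D \<subseteq> P" using no P(4) by blast
          have "P = D" by (rule connD[OF D(1) 1 P(1) 2])
          then show False using False P(2) by blast
        qed
        then obtain y where y: "y \<in> att P" "y \<in> D" "y \<in> B" by blast
        have "P \<subseteq> V - B" using P(2) D(2) by blast
        then have c: "clq (att P \<inter> B)" using Bc P(3) by blast
        have xP: "x \<in> att P \<inter> B" using attI[OF P(1) d(2)] x(1) B1(2) by blast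
        have yP: "y \<in> att P \<inter> B" using y by blast
        have yB': "y \<notin> B'" using y(2) D(2) by blast
        then have "x \<noteq> y" using x(1) unfolding B'_def by blast
        then have "adj x y" using clqD[OF c xP yP] by blast
        then have "y \<in> att B1" using attI[OF x(1)] by blast
        then show False using B1(4) yB' y(3) unfolding B'_def by blast
      qed
      then have "att D \<inter> B' \<subseteq> K" unfolding B'_def by blast
      then show ?thesis using clq_subset[OF K(2)] by blast
    qed
    moreover have "H \<subseteq> B'" using HB1 unfolding B'_def by blast
    ultimately have "good B'" unfolding good_def using B'B BV H(1) by blast
    then have "B' = B" using min[of B'] card_seteq[OF finB B'B] by blast
    then have "B - K = B1" using B1(2) unfolding B'_def by blast
    then show "conn (B - K)" using B1(3) by simp
  qed
  then show ?thesis using that[OF BV H] Bc by blast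
qed

definition NC_vertex :: "'a set \<Rightarrow> 'a \<Rightarrow> bool" where
  "NC_vertex V u \<longleftrightarrow> (\<forall>H H'. hole H \<longrightarrow> H \<subseteq> V \<longrightarrow> u \<in> H \<longrightarrow>
     hole H' \<longrightarrow> H' \<subseteq> V \<longrightarrow> u \<notin> H' \<longrightarrow> \<not> share_P3 H' H)"

text \<open>Let \<open>D\<close> be the component of \<open>u\<close> outside \<open>B\<close>. If
  \<open>D\<close> attaches to some hole of \<open>B\<close> in a nonclique, then \<open>u\<close>
  is adjacent to that hole, next to all of \<open>B\<close>, and finally to all other vertices,
  although it has a nonneighbour on \<open>Hu\<close>. So \<open>D\<close> attaches to each hole of
  \<open>B\<close> in a clique; but \<open>V\<close> is an atom, so \<open>D\<close> has nonadjacent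
  attachments \<open>a\<close> and \<open>b\<close>, and a hole through \<open>a\<close> as near as
  possible to \<open>b\<close> leads to a forbidden detour.\<close>

lemma atom_holes_contain:
  assumes fin: "finite V" and at: "atom V" and tr: "transversal V X" and NC: "NC_vertex V u"
    and Hu: "hole Hu" "Hu \<subseteq> V" "u \<in> Hu" and H0: "hole H0" "H0 \<subseteq> V"
  shows "u \<in> H0"
proof (rule ccontr)
  assume "u \<notin> H0"
  then have "H0 \<subseteq> V - {u}" using H0(2) by blast
  moreover have "finite (V - {u})" using fin by simp
  ultimately obtain B HB where BV': "B \<subseteq> V - {u}" and HB: "hole HB" "HB \<subseteq> B" and atB: "atom B"
    and Bc: "\<And>D. conn D \<Longrightarrow> D \<subseteq> V - {u} - B \<Longrightarrow> clq (att D \<inter> B)"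
    using atom_with_clq_attachments[OF _ H0(1), of "V - {u}" thesis] by blast
  have BV: "B \<subseteq> V" "u \<notin> B" using BV' by auto
  have uV: "u \<in> V" using Hu(2,3) by blast
  have ncB: "\<not> clq S" if "B \<subseteq> S" for S
    using hole_not_clq[OF HB(1)] clq_subset[of S HB] HB(2) that by blast
  have "u \<in> V - B" using uV BV(2) by blast
  then obtain D where D: "u \<in> D" "D \<subseteq> V - B" "conn D" "att D \<inter> (V - B) \<subseteq> D"
    by (rule component_exists)
  have nohole: "\<not> share_P3 H H'" if "hole H" "H \<subseteq> B" "hole H'" "H' \<subseteq> V" "u \<in> H'" for H H'
  proof -
    have "u \<notin> H" "H \<subseteq> V" using that(2) BV by auto
    then show ?thesis using NC that unfolding NC_vertex_def by blast
  qed
  \<comment> \<open>Away from \<open>u\<close>, each connected piece outside \<open>B\<close>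
    attaches along a clique, and a clique does not separate a hole.\<close>
  have stay: "H' \<subseteq> B" if H': "hole H'" "H' \<subseteq> B \<union> D" "u \<notin> H'" "\<not> clq (H' \<inter> B)" for H'
  proof (rule ccontr)
    assume "\<not> H' \<subseteq> B"
    then obtain d where d: "d \<in> H'" "d \<in> D" using H'(2) by blast
    then have "d \<in> H' \<inter> D" by blast
    then obtain P where P: "d \<in> P" "P \<subseteq> H' \<inter> D" "conn P" "att P \<inter> (H' \<inter> D) \<subseteq> P"
      by (rule component_exists)
    have PV: "P \<subseteq> V - {u} - B" using P(2) D(2) H'(3) by blast
    have c: "clq (att P \<inter> B)" by (rule Bc[OF P(3) PV])
    have 1: "P \<inter> (att P \<inter> B) = {}" using PV by blast
    have 2: "att P \<inter> H' \<subseteq> P \<union> (att P \<inter> B)" using P(4) H'(2) by blast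
    have 3: "d \<in> P \<inter> H'" using P(1) d(1) by blast
    have "H' \<inter> B \<subseteq> H' - P" using PV by blast
    then have 4: "\<not> clq (H' - P)" using H'(4) clq_subset by blast
    show False by (rule hole_part_clq_attached[OF H'(1) c 1 2 3 4])
  qed
  \<comment> \<open>A hub other than \<open>u\<close> would attach to a whole hole, which is no
    clique. A detour hole would avoid \<open>u\<close> by NC, and then lie in \<open>B\<close> by
    \<open>stay\<close>.\<close>
  have F1: "\<forall>h\<in>H. adj u h" if H: "hole H" "H \<subseteq> B" and nc: "\<not> clq (att D \<inter> H)" for H
  proof -
    have HV: "H \<subseteq> V" using H(2) BV by blast
    have DV: "D \<subseteq> V" using D(2) by blast
    have dis: "D \<inter> H = {}" using D(2) H(2) by blast
    show ?thesis
    proof (rule attached_hole[OF tr H(1) HV D(3) DV dis nc])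
      fix d assume d: "d \<in> D" "\<And>h. h \<in> H \<Longrightarrow> adj d h"
      have "d = u"
      proof (rule ccontr)
        assume "d \<noteq> u"
        then have "{d} \<subseteq> V - {u} - B" using d(1) D(2) by blast
        then have "clq (att {d} \<inter> B)" by (rule Bc[OF conn_single])
        moreover have "H \<subseteq> att {d} \<inter> B" using d(2) H(2) attI[of d "{d}"] by blast
        ultimately have "clq H" by (rule clq_subset)
        then show False using hole_not_clq[OF H(1)] by blast
      qed
      then show ?thesis using d(2) by blast
    next
      fix H' assume H': "hole H'" "H' \<subseteq> H \<union> D" "H' \<inter> D \<noteq> {}" "share_P3 H H'"
      have "H' \<subseteq> V" using H'(2) HV DV by blast
      then have uH': "u \<notin> H'" using nohole[OF H H'(1)] H'(4) by blast
      have "H \<inter> H' \<subseteq> H' \<inter> B" using H(2) by blast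
      then have "\<not> clq (H' \<inter> B)" by (rule share_P3_not_clq[OF H(1) H'(4)])
      then have "H' \<subseteq> B" using stay[OF H'(1) _ uH'] H'(2) H(2) by blast
      then show ?thesis using H'(3) D(2) by blast
    qed
  qed
  have F2: "clq (att D \<inter> H)" if H: "hole H" "H \<subseteq> B" for H
  proof (rule ccontr)
    assume "\<not> clq (att D \<inter> H)"
    then have uH: "\<And>h. h \<in> H \<Longrightarrow> adj u h" using F1[OF H] by blast
    have F1': "adj u h" if H': "hole H'" "H' \<subseteq> B" "x \<in> H'" "y \<in> H'" "adj u x" "adj u y" "x \<noteq> y" "\<not> adj x y"
      and h: "h \<in> H'" for H' x y h
    proof -
      have "x \<in> att D \<inter> H'" "y \<in> att D \<inter> H'" using attI[OF D(1)] H'(3-6) by auto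
      then have "\<not> clq (att D \<inter> H')" using H'(7,8) clqD[of "att D \<inter> H'" x y] by blast
      then show ?thesis using F1[OF H'(1,2)] h by blast
    qed
    have Bu: "adj u y" if yB: "y \<in> B" for y
    proof (rule ccontr)
      assume "\<not> adj u y"
      then have "y \<in> {z \<in> B. \<not> adj u z}" using yB by blast
      then obtain C where C: "y \<in> C" "C \<subseteq> {z \<in> B. \<not> adj u z}" "conn C" "att C \<inter> {z \<in> B. \<not> adj u z} \<subseteq> C"
        by (rule component_exists)
      have CB: "C \<subseteq> B" using C(2) by blast
      \<comment> \<open>A vertex of \<open>B\<close> beyond \<open>C\<close> and its attachments
        lies in a component \<open>C2\<close> having nonadjacent attachments \<open>a\<close> and
        \<open>b\<close>. Both border \<open>C\<close> as well and are adjacent to \<open>u\<close>,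
        so \<open>F1'\<close> makes \<open>u\<close> adjacent to a whole hole through
        \<open>C\<close> and \<open>C2\<close>, though \<open>C\<close> consists of nonneighbours of
        \<open>u\<close>.\<close>
      have all: "B \<subseteq> C \<union> att C"
      proof (rule ccontr)
        assume "\<not> B \<subseteq> C \<union> att C"
        then obtain z where z: "z \<in> B - att C" "z \<notin> C" by blast
        from z(1) obtain C2 where C2: "z \<in> C2" "C2 \<subseteq> B - att C" "conn C2" "att C2 \<inter> (B - att C) \<subseteq> C2"
          by (rule component_exists)
        have CC2: "C \<inter> C2 = {}"
        proof (rule ccontr)
          assume "C \<inter> C2 \<noteq> {}"
          then obtain t where t: "t \<in> C \<inter> C2" by blast
          have 1: "C \<inter> C2 \<subseteq> C2" by blast
          have 2: "att (C \<inter> C2) \<inter> C2 \<subseteq> C \<inter> C2" using C2(2) att_mono[of "C \<inter> C2" C] by blast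
          have "C \<inter> C2 = C2" by (rule connD[OF C2(3) 1 t 2])
          then show False using C2(1) z(2) by blast
        qed
        have CC2': "att C \<inter> C2 = {}" using C2(2) by blast
        have "y \<notin> att C2"
        proof
          assume "y \<in> att C2"
          then obtain t where "t \<in> C2" "adj t y" by (rule attE)
          then have "t \<in> att C \<inter> C2" using attI[OF C(1)] adj_sym by blast
          then show False using CC2' by blast
        qed
        moreover have "y \<in> B - C2" using yB C(1) CC2 by blast
        moreover have "C2 \<subseteq> B" using C2(2) by blast
        ultimately obtain a b where ab: "a \<in> att C2 \<inter> (B - C2)" "b \<in> att C2 \<inter> (B - C2)" "a \<noteq> b" "\<not> adj a b"
          using atom_attach[OF atB _ C2(1), of y thesis] by blast
        have abC: "x \<in> att C" "x \<notin> C" "adj u x" "x \<in> B" "x \<in> att C2" "x \<notin> C2" if x: "x \<in> att C2 \<inter> (B - C2)" for x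
        proof -
          show xB: "x \<in> B" "x \<in> att C2" "x \<notin> C2" using x by auto
          show xC: "x \<in> att C" using x C2(4) by blast
          obtain t where t: "t \<in> C2" "adj t x" using xB(2) by (rule attE)
          show xnC: "x \<notin> C"
          proof
            assume "x \<in> C"
            then have "t \<in> att C" using attI[of x C t] t(2) adj_sym by blast
            then show False using t(1) CC2' by blast
          qed
          show "adj u x" using C(4) xC xB(1) xnC by blast
        qed
        have aC: "a \<notin> C \<union> C2" "b \<notin> C \<union> C2" using abC[OF ab(1)] abC[OF ab(2)] by blast+
        obtain H3 where H3: "hole H3" "H3 \<subseteq> C \<union> C2 \<union> {a, b}" "a \<in> H3" "b \<in> H3" "H3 \<inter> C \<noteq> {}"
          by (rule two_sided_hole[OF C(3) C2(3) CC2 CC2' abC(1)[OF ab(1)] abC(1)[OF ab(2)]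
                abC(5)[OF ab(1)] abC(5)[OF ab(2)] aC ab(3,4)])
        have "H3 \<subseteq> B" using H3(2) CB C2(2) ab(1,2) by blast
        then have "adj u h" if "h \<in> H3" for h
          using F1'[OF H3(1) _ H3(3,4) abC(3)[OF ab(1)] abC(3)[OF ab(2)] ab(3,4) that] by blast
        then show False using H3(5) C(2) by blast
      qed
      have dis: "C \<inter> H = {}" using C(2) uH by blast
      then have "H \<subseteq> att C \<inter> H" using all H(2) by blast
      then have nc: "\<not> clq (att C \<inter> H)" using hole_not_clq[OF H(1)] clq_subset by blast
      have HV: "H \<subseteq> V" "C \<subseteq> V" using H(2) CB BV by blast+
      \<comment> \<open>A hub in \<open>C\<close> would be adjacent to \<open>u\<close>, which is
        another hub of \<open>H\<close>. A detour hole contains two nonadjacent vertices of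
        \<open>H\<close>, so \<open>u\<close> would be adjacent to all of it, including its part in
        \<open>C\<close>.\<close>
      show False
      proof (rule attached_hole[OF tr H(1) HV(1) C(3) HV(2) dis nc])
        fix d assume d: "d \<in> C" "\<And>h. h \<in> H \<Longrightarrow> adj d h"
        have "u \<noteq> d" "d \<in> V" using d(1) CB BV by auto
        then have "adj u d" using hubs_adjacent[OF tr H(1) HV(1) uV, of d] uH d(2) by blast
        then show False using d(1) C(2) by blast
      next
        fix H' assume H': "hole H'" "H' \<subseteq> H \<union> C" "H' \<inter> C \<noteq> {}" "share_P3 H H'"
        have H'B: "H' \<subseteq> B" using H'(2) H(2) CB by blast
        have "\<not> clq (H \<inter> H')" by (rule share_P3_not_clq[OF H(1) H'(4)]) simp
        then obtain x z where xz: "x \<in> H \<inter> H'" "z \<in> H \<inter> H'" "x \<noteq> z" "\<not> adj x z" by (rule not_clqE)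
        have "adj u h" if "h \<in> H'" for h
          using F1'[OF H'(1) H'B _ _ uH uH xz(3,4) that] xz(1,2) by blast
        then show False using H'(3) C(2) by blast
      qed
    qed
    \<comment> \<open>The attachments of any further component lie in a clique of \<open>B\<close>
      together with \<open>u\<close>, which is adjacent to all of \<open>B\<close>. They would form
      a clique cutset of \<open>V\<close>.\<close>
    have VB: "V \<subseteq> insert u B"
    proof (rule ccontr)
      assume "\<not> V \<subseteq> insert u B"
      then obtain y where "y \<in> V - {u} - B" by blast
      then obtain C where C: "y \<in> C" "C \<subseteq> V - {u} - B" "conn C" "att C \<inter> (V - {u} - B) \<subseteq> C"
        by (rule component_exists)
      have cC: "clq (att C \<inter> B)" by (rule Bc[OF C(3,2)])
      have "\<not> B \<subseteq> att C \<inter> B" using ncB cC by blast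
      then obtain z where z: "z \<in> B" "z \<notin> att C" by blast
      have CV: "C \<subseteq> V" "z \<in> V - C" using C(2) z(1) BV by blast+
      obtain a b where ab: "a \<in> att C \<inter> (V - C)" "b \<in> att C \<inter> (V - C)" "a \<noteq> b" "\<not> adj a b"
        by (rule atom_attach[OF at CV(1) C(1) CV(2) z(2)])
      have in_uB: "x = u \<or> x \<in> att C \<inter> B" if "x \<in> att C \<inter> (V - C)" for x using C(4) that by blast
      have "adj a b"
        using in_uB[OF ab(1)] in_uB[OF ab(2)] clqD[OF cC, of a b] ab(3) Bu adj_sym[of u a] by blast
      then show False using ab(4) by blast
    qed
    obtain p q r where "r \<in> Hu" "r \<noteq> u" "\<not> adj u r" using Hu(1,3) by (rule hole_nbrs)
    then show False using VB Hu(2) Bu by blast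
  qed
  have "\<exists>z\<in>B. z \<notin> att D"
  proof (rule ccontr)
    assume "\<not> (\<exists>z\<in>B. z \<notin> att D)"
    then have "HB \<subseteq> att D \<inter> HB" using HB(2) by blast
    then show False using F2[OF HB] hole_not_clq[OF HB(1)] clq_subset by blast
  qed
  then obtain z where z: "z \<in> B" "z \<notin> att D" by blast
  have DV: "D \<subseteq> V" "z \<in> V - D" using D(2) z(1) BV by auto
  obtain a b where ab: "a \<in> att D \<inter> (V - D)" "b \<in> att D \<inter> (V - D)" "a \<noteq> b" "\<not> adj a b"
    by (rule atom_attach[OF at DV(1) D(1) DV(2) z(2)])
  have abB: "a \<in> B" "b \<in> B" "a \<in> att D" "b \<in> att D" using ab(1,2) D(4) by blast+
  have notboth: False if "hole H" "H \<subseteq> B" "a \<in> H" "b \<in> H" for H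
    using clqD[OF F2[OF that(1,2)], of a b] that(3,4) abB ab(3,4) by blast
  \<comment> \<open>No subset of \<open>F\<close> attaches to \<open>a\<close>, which is the
    condition under which \<open>gap_hole\<close> gives a detour through \<open>F\<close> that still
    contains \<open>a\<close>.\<close>
  have "b \<in> {y \<in> B. y \<noteq> a \<and> \<not> adj a y}" using abB ab by blast
  then obtain F where F: "b \<in> F" "F \<subseteq> {y \<in> B. y \<noteq> a \<and> \<not> adj a y}" "conn F"
    "att F \<inter> {y \<in> B. y \<noteq> a \<and> \<not> adj a y} \<subseteq> F"
    by (rule component_exists)
  have FB: "F \<subseteq> B" "a \<in> B - F" using F(2) abB by auto
  have aF: "a \<notin> att Y" if "Y \<subseteq> F" for Y
  proof
    assume "a \<in> att Y"
    then obtain t where "t \<in> Y" "adj t a" by (rule attE)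
    then show False using F(2) that adj_sym[of t a] by blast
  qed
  have "\<exists>H. hole H \<and> H \<subseteq> B \<and> a \<in> H \<and> H \<inter> F \<noteq> {}"
  proof -
    obtain p q where pq: "p \<in> att F \<inter> (B - F)" "q \<in> att F \<inter> (B - F)" "p \<noteq> q" "\<not> adj p q"
      using atom_attach[OF atB FB(1) F(1) FB(2)] aF by blast
    have pqa: "adj a x" "x \<noteq> a" if "x \<in> att F \<inter> (B - F)" for x
      using F(4) aF[of F] that by blast+
    obtain f where f: "f \<in> F" "adj f p" using pq(1) attE by blast
    obtain g where g: "g \<in> F" "adj g q" using pq(2) attE by blast
    have "conn (insert p F)" by (rule conn_insert[OF F(3) f])
    then have cS: "conn (insert q (insert p F))" using conn_insert[of "insert p F" g q] g by blast
    have aS: "a \<notin> insert q (insert p F)" using pqa(2)[OF pq(1)] pqa(2)[OF pq(2)] FB(2) by blast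
    have adj: "adj a y \<longleftrightarrow> y = p \<or> y = q" if "y \<in> insert q (insert p F)" for y
      using that pqa(1)[OF pq(1)] pqa(1)[OF pq(2)] F(2) by blast
    obtain H where H: "hole H" "{a, p, q} \<subseteq> H" "H \<subseteq> insert a (insert q (insert p F))"
      by (rule hole_through[OF cS _ _ pq(3,4) aS adj]) simp_all
    obtain r where r: "r \<in> H" "r \<noteq> a" "\<not> adj a r" using hole_nbrs[OF H(1), of a] H(2) by blast
    then have "r \<in> F" using H(3) pqa(1)[OF pq(1)] pqa(1)[OF pq(2)] by blast
    moreover have "H \<subseteq> B" using H(3) FB pq(1,2) by blast
    ultimately show ?thesis using H(1,2) r(1) by blast
  qed
  then obtain H1 f where H1: "hole H1" "H1 \<subseteq> B" "a \<in> H1" "f \<in> H1" "f \<in> F" by blast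
  \<comment> \<open>Among the holes in \<open>B\<close> through \<open>a\<close>, take one as close to \<open>b\<close> inside \<open>F\<close> as possible.\<close>
  define W where "W fs \<longleftrightarrow> ipath fs \<and> fs \<noteq> [] \<and> hd fs = b \<and> set fs \<subseteq> F \<and>
      (\<exists>H. hole H \<and> H \<subseteq> B \<and> a \<in> H \<and> last fs \<in> H)" for fs
  obtain fs0 where "ipath fs0" "fs0 \<noteq> []" "hd fs0 = b" "last fs0 = f" "set fs0 \<subseteq> F"
    by (rule ipath_exists[OF F(3,1) H1(5)])
  then have "W fs0" unfolding W_def using H1 by blast
  then obtain fs where fs: "W fs" and min: "\<And>gs. W gs \<Longrightarrow> length fs \<le> length gs"
    using ex_has_least_nat[of W fs0 length] by blast
  obtain H where H: "hole H" "H \<subseteq> B" "a \<in> H" "last fs \<in> H" using fs unfolding W_def by blast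
  have fsF: "ipath fs" "fs \<noteq> []" "hd fs = b" "set fs \<subseteq> F" using fs unfolding W_def by auto
  have HV: "H \<subseteq> V" using H(2) BV by blast
  define Y where "Y = set (butlast fs)"
  have fs_eq: "fs = butlast fs @ [last fs]" using fsF(2) by simp
  have bne: "butlast fs \<noteq> []"
  proof
    assume "butlast fs = []"
    then have "last fs = b" using fs_eq fsF(3) by (metis append_Nil list.sel(1))
    then show False using notboth[OF H(1-3)] H(4) by simp
  qed
  then have "hd (butlast fs) = b" using fs_eq fsF(3) by (metis hd_append2)
  then have bY: "b \<in> Y" unfolding Y_def using bne hd_in_set by blast
  have ipY: "ipath (butlast fs)" using fsF(1) fs_eq ipath_prefix by metis
  have YF: "Y \<subseteq> F" unfolding Y_def using fsF(4) by (meson in_set_butlastD subset_iff)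
  have YB: "Y \<subseteq> B" using YF FB by blast
  have cY: "conn Y" unfolding Y_def by (rule conn_ipath[OF ipY])
  have closer: False if H': "hole H'" "H' \<subseteq> B" "a \<in> H'" "y \<in> H'" "y \<in> Y" for H' y
  proof -
    obtain us vs where uv: "butlast fs = us @ y # vs" using H'(5) unfolding Y_def by (meson split_list)
    then have e: "fs = (us @ [y]) @ (vs @ [last fs])" using fs_eq by simp
    have "ipath (us @ [y])" by (rule ipath_prefix[of _ "vs @ [last fs]"]) (use fsF(1) e in simp)
    moreover have "hd (us @ [y]) = b" using fsF(3) e by (metis append_is_Nil_conv hd_append2 list.distinct(1))
    moreover have "set (us @ [y]) \<subseteq> F" using fsF(4) e by (metis le_supE set_append)
    ultimately have "W (us @ [y])" unfolding W_def using H' by auto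
    then have "length fs \<le> length (us @ [y])" by (rule min)
    moreover have "length fs = length (us @ [y]) + length (vs @ [last fs])" using e by (metis length_append)
    ultimately show False by simp
  qed
  have YH: "Y \<inter> H = {}" using closer[OF H(1-3)] by blast
  have cYH: "clq (att Y \<inter> H)"
  proof (rule ccontr)
    assume nc: "\<not> clq (att Y \<inter> H)"
    obtain H' where H': "hole H'" "H' \<subseteq> H \<union> Y" "H' \<inter> Y \<noteq> {}" "a \<in> H'" "share_P3 H H'"
      by (rule gap_hole[OF H(1,3) cY YH aF[OF YF] nc])
    have "H' \<subseteq> B" using H'(2) H(2) YB by blast
    then show False using closer[OF H'(1) _ H'(4)] H'(3) by blast
  qed
  have lastY: "last fs \<in> att Y"
  proof -
    have "adj (last (butlast fs)) (last fs)"
      using fsF(1) fs_eq ipath_snoc[of "butlast fs" "last fs"] bne by (metis last_in_set)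
    then show ?thesis using attI[of "last (butlast fs)" Y] bne unfolding Y_def by simp
  qed
  have lastF: "last fs \<in> F" using fsF(2,4) by (meson last_in_set subsetD)
  obtain d where d: "d \<in> D" "adj d b" using abB(4) by (rule attE)
  \<comment> \<open>\<open>D\<close> and \<open>Y\<close> each attach to \<open>H\<close> in a
    clique, but their union attaches to the nonadjacent vertices \<open>a\<close> and
    \<open>last fs\<close>. A hub would lie in one of the two, which is impossible; a detour avoids
    \<open>u\<close>, so it stays in \<open>B\<close> and enters only \<open>Y\<close>, where the
    clique \<open>att Y \<inter> H\<close> would separate it.\<close>
  have cDY: "conn (D \<union> Y)" by (rule conn_Un[OF D(3) cY d(1) bY]) (simp add: d(2))
  have DYV: "D \<union> Y \<subseteq> V" using D(2) YB BV by blast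
  have DYH: "(D \<union> Y) \<inter> H = {}" using D(2) H(2) YH by blast
  have "a \<noteq> last fs" "\<not> adj a (last fs)" using lastF F(2) by auto
  moreover have "a \<in> att (D \<union> Y) \<inter> H" "last fs \<in> att (D \<union> Y) \<inter> H"
    using abB(3) lastY H(3,4) att_Un by auto
  ultimately have nc: "\<not> clq (att (D \<union> Y) \<inter> H)" using clqD[of "att (D \<union> Y) \<inter> H" a "last fs"] by blast
  show False
  proof (rule attached_hole[OF tr H(1) HV cDY DYV DYH nc])
    fix d assume d: "d \<in> D \<union> Y" "\<And>h. h \<in> H \<Longrightarrow> adj d h"
    then have "H \<subseteq> att D \<inter> H \<or> H \<subseteq> att Y \<inter> H" using attI[of d] by blast
    then show False using F2[OF H(1,2)] cYH hole_not_clq[OF H(1)] clq_subset by blast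
  next
    fix H' assume H': "hole H'" "H' \<subseteq> H \<union> (D \<union> Y)" "H' \<inter> (D \<union> Y) \<noteq> {}" "share_P3 H H'"
    have "H' \<subseteq> V" using H'(2) HV DYV by blast
    then have uH': "u \<notin> H'" using nohole[OF H(1,2) H'(1)] H'(4) by blast
    have "H \<inter> H' \<subseteq> H' \<inter> B" using H(2) by blast
    then have "\<not> clq (H' \<inter> B)" by (rule share_P3_not_clq[OF H(1) H'(4)])
    moreover have "H' \<subseteq> B \<union> D" using H'(2) H(2) YB by blast
    ultimately have H'B: "H' \<subseteq> B" using stay[OF H'(1) _ uH'] by blast
    then have H'D: "H' \<inter> D = {}" using D(2) by blast
    then obtain y where y: "y \<in> Y \<inter> H'" using H'(3) by blast
    have 1: "Y \<inter> (att Y \<inter> H) = {}" using YH by blast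
    have 2: "att Y \<inter> H' \<subseteq> Y \<union> (att Y \<inter> H)" using H'(2) H'D by blast
    have "H \<inter> H' \<subseteq> H' - Y" using YH by blast
    then have 3: "\<not> clq (H' - Y)" by (rule share_P3_not_clq[OF H(1) H'(4)])
    show False by (rule hole_part_clq_attached[OF H'(1) cYH 1 2 y 3])
  qed
qed

section \<open>Vertices of low degree\<close>

text \<open>No edge joins the two sides of a cutset, so the clique \<open>Q\<close> misses one of
  them; that side is \<open>C\<close>. Vertices of \<open>C\<close> keep their full neighbourhood in
  \<open>K \<union> C\<close>.\<close>

lemma not_atom_split:
  assumes "\<not> atom V" "clq Q"
  obtains K C where "K \<subseteq> V" "clq K" "C \<noteq> {}" "C \<inter> K = {}" "K \<union> C \<subset> V" "C \<inter> Q = {}"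
    "att C \<inter> V \<subseteq> K \<union> C"
proof -
  obtain K where K: "K \<subseteq> V" "clq K" "\<not> conn (V - K)" using assms(1) unfolding atom_def by blast
  obtain T where T: "T \<subseteq> V - K" "T \<noteq> {}" "att T \<inter> (V - K) \<subseteq> T" "T \<noteq> V - K"
    using K(3) unfolding conn_def by blast
  define T' where "T' = V - K - T"
  have T': "T' \<noteq> {}" "T' \<inter> K = {}" "T' \<subseteq> V" using T(1,4) unfolding T'_def by blast+
  have cl: "\<not> adj x y" if "x \<in> T" "y \<in> T'" for x y
    using attI[OF that(1), of y] T(3) that(2) unfolding T'_def by blast
  have attT': "att T' \<inter> V \<subseteq> K \<union> T'"
  proof
    fix x assume x: "x \<in> att T' \<inter> V"
    then have "x \<in> att T'" by simp
    then obtain y where "y \<in> T'" "adj y x" by (rule attE)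
    then have "x \<notin> T" using cl[of x y] adj_sym by blast
    then show "x \<in> K \<union> T'" using x unfolding T'_def by blast
  qed
  have attT: "att T \<inter> V \<subseteq> K \<union> T" using T(3) by blast
  have "T \<inter> Q = {} \<or> T' \<inter> Q = {}"
  proof (rule ccontr)
    assume "\<not> ?thesis"
    then obtain x y where xy: "x \<in> T" "x \<in> Q" "y \<in> T'" "y \<in> Q" by blast
    then have "x \<noteq> y" unfolding T'_def by blast
    then show False using clqD[OF assms(2) xy(2,4)] cl[OF xy(1,3)] by blast
  qed
  then show ?thesis
  proof
    assume Q: "T \<inter> Q = {}"
    have "T \<inter> K = {}" "K \<union> T \<subset> V" using T(1) T' K(1) unfolding T'_def by blast+
    then show ?thesis using that[OF K(1,2) T(2) _ _ Q attT] by blast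
  next
    assume Q: "T' \<inter> Q = {}"
    have "K \<union> T' \<subset> V" using T(1,2) K(1) unfolding T'_def by blast
    then show ?thesis using that[OF K(1,2) T'(1,2) _ Q attT'] by blast
  qed
qed

text \<open>For nonadjacent \<open>v\<close> and \<open>w\<close>, the component of \<open>w\<close>
  among the nonneighbours of \<open>v\<close> has two nonadjacent attachments. Both are neighbours
  of \<open>v\<close>, so \<open>v\<close> closes a path between them through the component.\<close>

lemma atom_clq_or_hole:
  assumes "atom V" "\<not> clq V"
  obtains H where "hole H" "H \<subseteq> V"
proof -
  obtain v w where vw: "v \<in> V" "w \<in> V" "v \<noteq> w" "\<not> adj v w" using assms(2) by (rule not_clqE)
  have "w \<in> {y \<in> V. y \<noteq> v \<and> \<not> adj v y}" using vw by blast
  then obtain F where F: "w \<in> F" "F \<subseteq> {y \<in> V. y \<noteq> v \<and> \<not> adj v y}" "conn F"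
    "att F \<inter> {y \<in> V. y \<noteq> v \<and> \<not> adj v y} \<subseteq> F"
    by (rule component_exists)
  have FV: "F \<subseteq> V" "v \<in> V - F" using F(2) vw by auto
  have vF: "v \<notin> att F"
  proof
    assume "v \<in> att F"
    then obtain t where "t \<in> F" "adj t v" by (rule attE)
    then show False using F(2) adj_sym[of t v] by blast
  qed
  obtain p q where pq: "p \<in> att F \<inter> (V - F)" "q \<in> att F \<inter> (V - F)" "p \<noteq> q" "\<not> adj p q"
    by (rule atom_attach[OF assms(1) FV(1) F(1) FV(2) vF])
  have pqv: "adj v x" "x \<noteq> v" if "x \<in> att F \<inter> (V - F)" for x
    using F(4) vF that by blast+
  obtain f where f: "f \<in> F" "adj f p" using pq(1) attE by blast
  obtain g where g: "g \<in> F" "adj g q" using pq(2) attE by blast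
  have "conn (insert p F)" by (rule conn_insert[OF F(3) f])
  then have cS: "conn (insert q (insert p F))" using conn_insert[of "insert p F" g q] g by blast
  have vS: "v \<notin> insert q (insert p F)" using pqv(2)[OF pq(1)] pqv(2)[OF pq(2)] FV(2) by blast
  have adj: "adj v y \<longleftrightarrow> y = p \<or> y = q" if "y \<in> insert q (insert p F)" for y
    using that pqv(1)[OF pq(1)] pqv(1)[OF pq(2)] F(2) by blast
  obtain H where H: "hole H" "{v, p, q} \<subseteq> H" "H \<subseteq> insert v (insert q (insert p F))"
    by (rule hole_through[OF cS _ _ pq(3,4) vS adj]) simp_all
  have "H \<subseteq> V" using H(3) FV pq(1,2) by blast
  then show ?thesis using that H(1) by blast
qed

text \<open>Dirac's theorem on chordal graphs. Asking for a vertex outside a prescribed clique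
  carries the induction: with \<open>K\<close> in the role of \<open>Q\<close>, the vertex found in
  \<open>K \<union> C\<close> lies in \<open>C\<close> and has the same neighbours in
  \<open>V\<close>.\<close>

lemma chordal_simplicial:
  assumes "finite V" "\<And>H. hole H \<Longrightarrow> \<not> H \<subseteq> V" "clq Q" "\<not> V \<subseteq> Q"
  shows "\<exists>v\<in>V - Q. clq (att {v} \<inter> V)"
  using assms
proof (induction "card V" arbitrary: V Q rule: less_induct)
  case less
  show ?case
  proof (cases "atom V")
    case True
    have "clq V"
    proof (rule ccontr)
      assume "\<not> clq V"
      then obtain H where "hole H" "H \<subseteq> V" by (rule atom_clq_or_hole[OF True])
      then show False using less.prems(2) by blast
    qed
    moreover obtain v where "v \<in> V - Q" using less.prems(4) by blast
    ultimately show ?thesis using clq_subset[of V "att {v} \<inter> V"] by blast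
  next
    case False
    obtain K C where KC: "K \<subseteq> V" "clq K" "C \<noteq> {}" "C \<inter> K = {}" "K \<union> C \<subset> V" "C \<inter> Q = {}"
      "att C \<inter> V \<subseteq> K \<union> C"
      by (rule not_atom_split[OF False less.prems(3)])
    have "card (K \<union> C) < card V" using psubset_card_mono[OF less.prems(1) KC(5)] .
    moreover have "finite (K \<union> C)" using finite_subset[of "K \<union> C" V] KC(5) less.prems(1) by blast
    moreover have "\<not> H \<subseteq> K \<union> C" if "hole H" for H using less.prems(2)[OF that] KC(5) by blast
    moreover have "\<not> K \<union> C \<subseteq> K" using KC(3,4) by blast
    ultimately obtain v where v: "v \<in> K \<union> C - K" "clq (att {v} \<inter> (K \<union> C))"
      using less.hyps[of "K \<union> C" K] KC(2) by blast
    have "v \<in> C" using v(1) by blast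
    then have "att {v} \<inter> V \<subseteq> att {v} \<inter> (K \<union> C)" using KC(7) att_mono[of "{v}" C] by blast
    then have "clq (att {v} \<inter> V)" using clq_subset[OF v(2)] by blast
    then show ?thesis using \<open>v \<in> C\<close> KC(5,6) by blast
  qed
qed

lemma transversal_subset: "transversal V X \<Longrightarrow> V' \<subseteq> V \<Longrightarrow> transversal V' X"
  unfolding transversal_def by (meson subset_trans)

lemma NC_vertex_subset: "NC_vertex V u \<Longrightarrow> V' \<subseteq> V \<Longrightarrow> NC_vertex V' u"
  unfolding NC_vertex_def by (meson subset_trans)

text \<open>The clique \<open>Q\<close> has the same purpose as in
  \<open>chordal_simplicial\<close>: it steers the vertex found in the smaller piece away from the
  cutset, where degrees could grow.\<close>

lemma NC_low_degree:
  assumes "finite V" "transversal V X" "\<And>u. u \<in> X \<Longrightarrow> NC_vertex V u"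
    and "\<And>K. K \<subseteq> V \<Longrightarrow> clq K \<Longrightarrow> card K \<le> m" "clq Q" "Q \<subseteq> V" "\<not> V \<subseteq> Q"
  shows "\<exists>v\<in>V - Q. card (att {v} \<inter> V) \<le> m"
  using assms
proof (induction "card V" arbitrary: V Q rule: less_induct)
  case less
  have simplicial: "card (att {v} \<inter> W) < m" if "v \<in> W" "W \<subseteq> V" "clq (att {v} \<inter> W)" for v W
  proof -
    have av: "adj v x" if "x \<in> att {v}" for x using attE[OF that, of "adj v x"] by blast
    have vn: "v \<notin> att {v} \<inter> W" using av[of v] adj_irrefl by blast
    have "clq (insert v (att {v} \<inter> W))"
      unfolding clq_def
    proof (intro ballI impI)
      fix x y assume xy: "x \<in> insert v (att {v} \<inter> W)" "y \<in> insert v (att {v} \<inter> W)" "x \<noteq> y"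
      consider "x = v" | "y = v" | "x \<in> att {v} \<inter> W" "y \<in> att {v} \<inter> W" using xy(1,2) by blast
      then show "adj x y"
      proof cases
        case 1 then show ?thesis using av[of y] xy(2,3) by blast
      next
        case 2 then show ?thesis using av[of x] xy(1,3) adj_sym[of v x] by blast
      next
        case 3 then show ?thesis using clqD[OF that(3)] xy(3) by blast
      qed
    qed
    moreover have "insert v (att {v} \<inter> W) \<subseteq> V" using that by blast
    ultimately have "card (insert v (att {v} \<inter> W)) \<le> m" using less.prems(4) by blast
    moreover have "finite (att {v} \<inter> W)" using less.prems(1) that(2) by (meson finite_Int finite_subset)
    ultimately show ?thesis using vn by simp
  qed
  show ?case
  proof (cases "atom V")
    case True
    show ?thesis
    proof (cases "\<exists>H. hole H \<and> H \<subseteq> V")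
      case False
      then obtain v where v: "v \<in> V - Q" "clq (att {v} \<inter> V)"
        using chordal_simplicial[OF less.prems(1) _ less.prems(5,7)] by blast
      then have "card (att {v} \<inter> V) < m" using simplicial[of v V] by blast
      then show ?thesis using v(1) less_imp_le by blast
    next
      case True
      then obtain H where H: "hole H" "H \<subseteq> V" by blast
      obtain u where u: "u \<in> H" "u \<in> X" by (rule transversal_meets[OF less.prems(2) H])
      have all: "u \<in> H'" if "hole H'" "H' \<subseteq> V" for H'
        by (rule atom_holes_contain[OF less.prems(1) \<open>atom V\<close> less.prems(2) less.prems(3)[OF u(2)] H u(1) that])
      show ?thesis
      \<comment> \<open>If \<open>u\<close> is the only vertex outside \<open>Q\<close>, it must be
        the answer itself; its degree is at most \<open>card Q\<close>, which the clique bound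
        controls.\<close>
      proof (cases "V - {u} \<subseteq> Q")
        case True
        then have "u \<in> V - Q" using less.prems(7) by blast
        have "att {u} \<inter> V \<subseteq> Q"
        proof
          fix x assume x: "x \<in> att {u} \<inter> V"
          then have "x \<noteq> u" using adj_irrefl attE[of x "{u}" "x \<noteq> u"] by blast
          then show "x \<in> Q" using x True by blast
        qed
        then have "card (att {u} \<inter> V) \<le> card Q"
          using card_mono less.prems(1,6) finite_subset by metis
        also have "\<dots> \<le> m" using less.prems(4-6) by blast
        finally show ?thesis using \<open>u \<in> V - Q\<close> by blast
      next
        case False
        have "\<not> H' \<subseteq> V - {u}" if "hole H'" for H' using all[OF that] by blast
        then obtain v where v: "v \<in> V - {u} - Q" "clq (att {v} \<inter> (V - {u}))"
          using chordal_simplicial[of "V - {u}" Q] less.prems(1,5) False by blast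
        have "card (att {v} \<inter> (V - {u})) < m" using simplicial[of v "V - {u}"] v by blast
        moreover have "att {v} \<inter> V \<subseteq> insert u (att {v} \<inter> (V - {u}))" by blast
        then have "card (att {v} \<inter> V) \<le> card (insert u (att {v} \<inter> (V - {u})))"
          using less.prems(1) by (intro card_mono) auto
        moreover have "card (insert u (att {v} \<inter> (V - {u}))) \<le> Suc (card (att {v} \<inter> (V - {u})))"
          using less.prems(1) by (simp add: card_insert_if)
        ultimately have "card (att {v} \<inter> V) \<le> m" by simp
        then show ?thesis using v(1) by blast
      qed
    qed
  next
    case False
    obtain K C where KC: "K \<subseteq> V" "clq K" "C \<noteq> {}" "C \<inter> K = {}" "K \<union> C \<subset> V" "C \<inter> Q = {}"
      "att C \<inter> V \<subseteq> K \<union> C"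
      by (rule not_atom_split[OF False less.prems(5)])
    have sub: "K \<union> C \<subseteq> V" using KC(5) by blast
    have 1: "card (K \<union> C) < card V" using psubset_card_mono[OF less.prems(1) KC(5)] .
    have 2: "finite (K \<union> C)" using finite_subset[OF sub less.prems(1)] .
    have 3: "transversal (K \<union> C) X" using transversal_subset[OF less.prems(2) sub] .
    have 4: "NC_vertex (K \<union> C) u" if "u \<in> X" for u using NC_vertex_subset[OF less.prems(3)[OF that] sub] .
    have 5: "card K' \<le> m" if "K' \<subseteq> K \<union> C" "clq K'" for K' using less.prems(4)[OF _ that(2)] that(1) sub by blast
    have 6: "\<not> K \<union> C \<subseteq> K" using KC(3,4) by blast
    have 7: "K \<subseteq> K \<union> C" by blast
    obtain v where v: "v \<in> K \<union> C - K" "card (att {v} \<inter> (K \<union> C)) \<le> m"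
      using less.hyps[OF 1 2 3 4 5 KC(2) 7 6] by blast
    have "v \<in> C" using v(1) by blast
    then have "att {v} \<inter> V = att {v} \<inter> (K \<union> C)" using KC(7) att_mono[of "{v}" C] sub by blast
    then have "card (att {v} \<inter> V) \<le> m" using v(2) by simp
    moreover have "v \<in> V - Q" using \<open>v \<in> C\<close> KC(6) sub by blast
    ultimately show ?thesis by blast
  qed
qed

section \<open>Translation into the cyclic list encoding of \<open>is_hole\<close>\<close>

lemma ipath_nth:
  assumes "ipath xs" "i < length xs" "j < length xs"
  shows "adj (xs ! i) (xs ! j) \<longleftrightarrow> j = Suc i \<or> i = Suc j"
  using assms
proof (induction xs arbitrary: i j)
  case (Cons x xs)
  have *: "adj x (xs ! n) \<longleftrightarrow> n = 0" if "n < length xs" for n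
  proof -
    have "xs \<noteq> []" using that by auto
    then have "hd xs = xs ! 0" by (rule hd_conv_nth)
    moreover have "distinct xs" using Cons.prems(1) ipath_distinct by simp
    ultimately show ?thesis
      using Cons.prems(1) that \<open>xs \<noteq> []\<close> nth_eq_iff_index_eq[of xs n 0] by auto
  qed
  show ?case
  proof (cases i)
    case 0
    show ?thesis
    proof (cases j)
      case 0 then show ?thesis using \<open>i = 0\<close> adj_irrefl by simp
    next
      case (Suc n) then show ?thesis using \<open>i = 0\<close> *[of n] Cons.prems(3) by simp
    qed
  next
    case i: (Suc m)
    show ?thesis
    proof (cases j)
      case 0 then show ?thesis using i *[of m] Cons.prems(2) adj_commute[of x "xs ! m"] by auto
    next
      case (Suc n) then show ?thesis using i Cons by simp
    qed
  qed
qed simp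

lemma is_hole_of_hole:
  assumes "hole H" "H \<subseteq> V" "\<And>x y. adj x y \<longleftrightarrow> {x, y} \<in> E"
  shows "is_hole V E H"
proof -
  obtain a xs where a: "hole_at a xs" "H = insert a (set xs)" using assms(1) unfolding hole_def by blast
  have xs: "ipath xs" "length xs \<ge> 3" "a \<notin> set xs" "distinct xs" "xs \<noteq> []"
    and ax: "\<And>y. y \<in> set xs \<Longrightarrow> adj a y \<longleftrightarrow> y = hd xs \<or> y = last xs"
    using a(1) ipath_distinct unfolding hole_at_def by auto
  let ?n = "length xs"
  have a_nth: "adj a (xs ! m) \<longleftrightarrow> m = 0 \<or> Suc m = ?n" if "m < ?n" for m
    using ax[of "xs ! m"] that xs nth_eq_iff_index_eq[OF xs(4), of m 0] nth_eq_iff_index_eq[OF xs(4), of m "?n - 1"]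
    by (auto simp: hd_conv_nth last_conv_nth)
  have "{(a # xs) ! i, (a # xs) ! j} \<in> E \<longleftrightarrow> j = Suc i mod Suc ?n \<or> i = Suc j mod Suc ?n"
    if "i < Suc ?n" "j < Suc ?n" for i j
  proof -
    have mod: "Suc k mod Suc ?n = (if k = ?n then 0 else Suc k)" if "k < Suc ?n" for k using that by auto
    have "adj ((a # xs) ! i) ((a # xs) ! j) \<longleftrightarrow>
        j = (if i = ?n then 0 else Suc i) \<or> i = (if j = ?n then 0 else Suc j)"
    proof (cases i)
      case i: 0
      show ?thesis
      proof (cases j)
        case 0 then show ?thesis using i xs(5) adj_irrefl by simp
      next
        case (Suc m) then show ?thesis using i a_nth[of m] that xs(2) by auto
      qed
    next
      case i: (Suc k)
      show ?thesis
      proof (cases j)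
        case 0
        then show ?thesis using i a_nth[of k] that(1) xs(2)
          by (simp add: adj_commute[of "xs ! k" a]) auto
      next
        case (Suc m)
        have "adj ((a # xs) ! i) ((a # xs) ! j) \<longleftrightarrow> m = Suc k \<or> k = Suc m"
          using ipath_nth[OF xs(1)] i Suc that by simp
        also have "\<dots> \<longleftrightarrow> j = (if i = ?n then 0 else Suc i) \<or> i = (if j = ?n then 0 else Suc j)"
          using i Suc that by auto
        finally show ?thesis .
      qed
    qed
    then have "adj ((a # xs) ! i) ((a # xs) ! j) \<longleftrightarrow> j = Suc i mod Suc ?n \<or> i = Suc j mod Suc ?n"
      unfolding mod[OF that(1)] mod[OF that(2)] .
    then show ?thesis using assms(3) by simp
  qed
  then show ?thesis unfolding is_hole_def
    using xs a assms(2) by (intro exI[of _ "a # xs"]) auto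
qed

end

section \<open>DP-colourings\<close>

text \<open>The vertex of small degree is coloured last. By the matching condition each coloured
  neighbour forbids at most one colour, so fewer than \<open>m\<close> are forbidden.\<close>

lemma degenerate_dp_colourable:
  assumes "finite V"
    and deg: "\<And>W. W \<subseteq> V \<Longrightarrow> W \<noteq> {} \<Longrightarrow> \<exists>v\<in>W. card {w \<in> W. {v, w} \<in> E} < m"
  shows "dp_colourable V E m"
  unfolding dp_colourable_def
proof (intro allI impI)
  fix HE :: "('a \<times> nat) set set"
  assume cov: "dp_cover V E m HE"
  have sg: "simple_graph (V \<times> {0..<m}) HE"
    and nonadj: "\<And>u v i j. u \<in> V \<Longrightarrow> v \<in> V \<Longrightarrow> u \<noteq> v \<Longrightarrow> {u, v} \<notin> E \<Longrightarrow> i < m \<Longrightarrow> j < m \<Longrightarrow>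
        {(u, i), (v, j)} \<notin> HE"
    and match: "\<And>u v i. u \<in> V \<Longrightarrow> v \<in> V \<Longrightarrow> u \<noteq> v \<Longrightarrow> i < m \<Longrightarrow>
        card {b \<in> cover_list v m. {(u, i), b} \<in> HE} \<le> 1"
    using cov unfolding dp_cover_def cover_list_def by auto
  have loop: "{a} \<notin> HE" for a
  proof
    assume "{a} \<in> HE"
    then obtain x y where xy: "x \<noteq> y" "{a} = {x, y}" using sg unfolding simple_graph_def by metis
    then have "x \<in> {a}" "y \<in> {a}" by simp_all
    then show False using xy(1) by simp
  qed
  have "\<exists>c. (\<forall>v\<in>W. c v < m) \<and> (\<forall>v\<in>W. \<forall>w\<in>W. {(v, c v), (w, c w)} \<notin> HE)" if "W \<subseteq> V" for W
    using that
  proof (induction "card W" arbitrary: W rule: less_induct)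
    case less
    show ?case
    proof (cases "W = {}")
      case True then show ?thesis by simp
    next
      case False
      obtain v where v: "v \<in> W" "card {w \<in> W. {v, w} \<in> E} < m" using deg[OF less.prems False] by blast
      have finW: "finite W" using less.prems assms(1) finite_subset by blast
      have "card (W - {v}) < card W" using card_Diff1_less[OF finW v(1)] .
      moreover have "W - {v} \<subseteq> V" using less.prems by blast
      ultimately obtain c where c: "\<And>w. w \<in> W - {v} \<Longrightarrow> c w < m"
        "\<And>u w. u \<in> W - {v} \<Longrightarrow> w \<in> W - {v} \<Longrightarrow> {(u, c u), (w, c w)} \<notin> HE"
        using less.hyps[of "W - {v}"] by blast
      define bad where "bad w = {j. j < m \<and> {(w, c w), (v, j)} \<in> HE}" for w
      define N where "N = {w \<in> W - {v}. {v, w} \<in> E}"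
      have bad1: "card (bad w) \<le> 1" if w: "w \<in> N" for w
      proof -
        have wV: "w \<in> V" "v \<in> V" "w \<noteq> v" "c w < m" using w c(1) v(1) less.prems unfolding N_def by auto
        have "Pair v ` bad w = {b \<in> cover_list v m. {(w, c w), b} \<in> HE}"
          unfolding bad_def cover_list_def by auto
        then have "card (Pair v ` bad w) \<le> 1" using match[OF wV] by simp
        then show ?thesis by (simp add: card_image inj_on_def)
      qed
      have finN: "finite N" unfolding N_def using finW by simp
      have "card (\<Union>w\<in>N. bad w) \<le> (\<Sum>w\<in>N. card (bad w))" by (rule card_UN_le[OF finN])
      also have "\<dots> \<le> (\<Sum>w\<in>N. 1)" by (rule sum_mono) (rule bad1)
      also have "\<dots> = card N" by simp
      also have "\<dots> \<le> card {w \<in> W. {v, w} \<in> E}"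
        by (rule card_mono) (use finW in \<open>auto simp: N_def\<close>)
      also have "\<dots> < card {..<m}" using v(2) by simp
      finally have "card (\<Union>w\<in>N. bad w) < card {..<m}" .
      moreover have "(\<Union>w\<in>N. bad w) \<subseteq> {..<m}" unfolding bad_def by blast
      ultimately obtain j where j: "j < m" "j \<notin> (\<Union>w\<in>N. bad w)"
        by (metis lessThan_iff less_irrefl subsetI subset_antisym)
      have new: "{(w, c w), (v, j)} \<notin> HE" if w: "w \<in> W - {v}" for w
      proof (cases "w \<in> N")
        case True then show ?thesis using j unfolding bad_def by blast
      next
        case False
        then have "{w, v} \<notin> E" using w unfolding N_def by (simp add: insert_commute)
        moreover have "w \<in> V" "v \<in> V" "w \<noteq> v" using w v(1) less.prems by auto
        ultimately show ?thesis using nonadj[of w v "c w" j] c(1)[OF w] j(1) by blast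
      qed
      define c' where "c' = c(v := j)"
      have "\<forall>w\<in>W. c' w < m" using c(1) j(1) unfolding c'_def by simp
      moreover have "{(u, c' u), (w, c' w)} \<notin> HE" if uw: "u \<in> W" "w \<in> W" for u w
      proof -
        consider "u = v" "w = v" | "u = v" "w \<noteq> v" | "u \<noteq> v" "w = v" | "u \<noteq> v" "w \<noteq> v" by blast
        then show ?thesis
        proof cases
          case 1 then show ?thesis using loop by simp
        next
          case 2 then show ?thesis using new[of w] uw unfolding c'_def by (simp add: insert_commute)
        next
          case 3 then show ?thesis using new[of u] uw unfolding c'_def by simp
        next
          case 4 then show ?thesis using c(2)[of u w] uw unfolding c'_def by simp
        qed
      qed
      ultimately show ?thesis by blast
    qed
  qed
  from this[OF subset_refl] obtain c where c: "\<forall>v\<in>V. c v < m"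
    "\<forall>v\<in>V. \<forall>w\<in>V. {(v, c v), (w, c w)} \<notin> HE" by (elim exE conjE)
  let ?I = "(\<lambda>v. (v, c v)) ` V"
  have "?I \<inter> cover_list v m = {(v, c v)}" if "v \<in> V" for v
    using that c(1) unfolding cover_list_def by auto
  then have "dp_colouring V m HE ?I"
    unfolding dp_colouring_def using c by auto
  then show "\<exists>I. dp_colouring V m HE I" by blast
qed

text \<open>In the cover that joins equal colours along each edge, a DP-colouring is an ordinary
  proper colouring, hence injective on \<open>K\<close>.\<close>

lemma clique_not_dp_colourable:
  assumes "finite V" "K \<subseteq> V" "clique_edges K \<subseteq> E" "m < card K"
  shows "\<not> dp_colourable V E m"
proof
  assume col: "dp_colourable V E m"
  define R :: "'a \<times> nat \<Rightarrow> 'a \<times> nat \<Rightarrow> bool" where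
    "R a b \<longleftrightarrow> a \<in> V \<times> {0..<m} \<and> b \<in> V \<times> {0..<m} \<and>
      (fst a = fst b \<and> snd a \<noteq> snd b \<or> fst a \<noteq> fst b \<and> {fst a, fst b} \<in> E \<and> snd a = snd b)" for a b
  define HE where "HE = {{a, b} | a b. R a b}"
  have Rsym: "R a b \<Longrightarrow> R b a" for a b unfolding R_def by (auto simp: insert_commute)
  have HE: "{a, b} \<in> HE \<longleftrightarrow> R a b" for a b
  proof
    assume "{a, b} \<in> HE"
    then obtain x y where "{a, b} = {x, y}" "R x y" unfolding HE_def by blast
    then show "R a b" using Rsym by (metis doubleton_eq_iff)
  next
    assume "R a b" then show "{a, b} \<in> HE" unfolding HE_def by blast
  qed
  have "simple_graph (V \<times> {0..<m}) HE"
    unfolding simple_graph_def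
  proof (intro conjI ballI)
    show "finite (V \<times> {0..<m})" using assms(1) by simp
    fix e assume "e \<in> HE"
    then obtain a b where "e = {a, b}" "R a b" unfolding HE_def by blast
    then show "\<exists>x y. x \<noteq> y \<and> x \<in> V \<times> {0..<m} \<and> y \<in> V \<times> {0..<m} \<and> e = {x, y}"
      by (intro exI[of _ a] exI[of _ b]) (auto simp: R_def)
  qed
  moreover have "clique_edges (cover_list u m) \<subseteq> HE" if "u \<in> V" for u
  proof
    fix e assume "e \<in> clique_edges (cover_list u m)"
    then obtain a b where ab: "a \<noteq> b" "a \<in> cover_list u m" "b \<in> cover_list u m" "e = {a, b}"
      unfolding clique_edges_def by blast
    then have "R a b" using that unfolding R_def cover_list_def by auto
    then show "e \<in> HE" using HE ab(4) by simp
  qed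
  moreover have "{a, b} \<notin> HE" if "u \<noteq> v" "{u, v} \<notin> E" "a \<in> cover_list u m" "b \<in> cover_list v m" for u v a b
    using that unfolding HE R_def cover_list_def by auto
  moreover have "card {b \<in> cover_list v m. {a, b} \<in> HE} \<le> 1" if "u \<noteq> v" "a \<in> cover_list u m" for u v a
  proof -
    have "{b \<in> cover_list v m. {a, b} \<in> HE} \<subseteq> {(v, snd a)}"
      using that unfolding HE R_def cover_list_def by auto
    then have "card {b \<in> cover_list v m. {a, b} \<in> HE} \<le> card {(v, snd a)}" by (intro card_mono) auto
    then show ?thesis by simp
  qed
  ultimately have "dp_cover V E m HE" unfolding dp_cover_def by blast
  then obtain I where I: "dp_colouring V m HE I" using col unfolding dp_colourable_def by blast
  have "\<exists>i<m. (v, i) \<in> I" if "v \<in> V" for v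
  proof -
    have "card (I \<inter> cover_list v m) = 1" using I that unfolding dp_colouring_def by blast
    then obtain a where "a \<in> I \<inter> cover_list v m" by (metis card.empty ex_in_conv zero_neq_one)
    then show ?thesis unfolding cover_list_def by auto
  qed
  then obtain c where c: "\<And>v. v \<in> V \<Longrightarrow> c v < m \<and> (v, c v) \<in> I" by metis
  have "inj_on c K"
  proof (rule inj_onI, rule ccontr)
    fix x y assume xy: "x \<in> K" "y \<in> K" "c x = c y" "x \<noteq> y"
    then have xV: "x \<in> V" "y \<in> V" using assms(2) by auto
    have "{x, y} \<in> E" using xy assms(3) unfolding clique_edges_def by blast
    then have "R (x, c x) (y, c y)" using xy xV c unfolding R_def by auto
    then have "{(x, c x), (y, c y)} \<in> HE" using HE by blast
    then show False using I c xV unfolding dp_colouring_def by blast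
  qed
  moreover have "c ` K \<subseteq> {..<m}" using c assms(2) by auto
  ultimately have "card K \<le> card {..<m}" by (rule card_inj_on_le) simp
  then show False using assms(4) by simp
qed

section \<open>Cliques on points of several lines\<close>

definition multi :: "(nat \<Rightarrow> 'a set) \<Rightarrow> nat \<Rightarrow> 'a set" where
  "multi L k = {x. \<exists>i<k. \<exists>j<k. i \<noteq> j \<and> x \<in> L i \<and> x \<in> L j}"

context
  fixes L :: "nat \<Rightarrow> 'a set" and k :: nat
  assumes line_Int: "\<And>i j x y. i < k \<Longrightarrow> j < k \<Longrightarrow> i \<noteq> j \<Longrightarrow>
    x \<in> L i \<Longrightarrow> x \<in> L j \<Longrightarrow> y \<in> L i \<Longrightarrow> y \<in> L j \<Longrightarrow> x = y"
begin

text \<open>Each point of \<open>S\<close> picks a second line through it. Two lines share at most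
  one point, so the picks are distinct members of the \<open>k - 1\<close> other lines.\<close>

lemma card_line_multi:
  assumes "i < k" "S \<subseteq> L i \<inter> multi L k"
  shows "card S < k"
proof -
  have "\<exists>j<k. j \<noteq> i \<and> x \<in> L j" if "x \<in> S" for x using assms(2) that unfolding multi_def by blast
  then obtain f where f: "\<And>x. x \<in> S \<Longrightarrow> f x < k \<and> f x \<noteq> i \<and> x \<in> L (f x)" by metis
  have "inj_on f S"
  proof (rule inj_onI)
    fix x y assume xy: "x \<in> S" "y \<in> S" "f x = f y"
    show "x = y"
      using line_Int[of i "f x" x y] f[OF xy(1)] f[OF xy(2)] xy assms by auto
  qed
  moreover have "f ` S \<subseteq> {..<k} - {i}" using f by auto
  ultimately have "card S \<le> card ({..<k} - {i})" by (rule card_inj_on_le) simp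
  also have "\<dots> < k" using assms(1) by simp
  finally show ?thesis .
qed

text \<open>Conway's proof of the de Bruijn--Erdos theorem: for a point \<open>p\<close> of degree \<open>r p\<close> off a line with
  \<open>s i\<close> points, \<open>s i \<le> r p\<close>; summing \<open>1 / (k - r p) \<ge> 1 / (k - s i)\<close> over all non-incident pairs gives
  \<open>k\<close> on the right and at most \<open>k\<close> on the left, so \<open>s i = r p\<close> throughout and any two lines meet in
  \<open>Q\<close>.\<close>

lemma clique_absorbs_multi:
  assumes Q: "finite Q" "card Q = k" "Q \<subseteq> multi L k"
    and joined: "\<And>x y. x \<in> Q \<Longrightarrow> y \<in> Q \<Longrightarrow> x \<noteq> y \<Longrightarrow> \<exists>i<k. x \<in> L i \<and> y \<in> L i"
  shows "multi L k \<subseteq> Q"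
proof (rule ccontr)
  define lines where "lines p = {i. i < k \<and> p \<in> L i}" for p
  define r where "r p = card (lines p)" for p
  define s where "s i = card (L i \<inter> Q)" for i
  have fin_lines: "finite (lines p)" for p unfolding lines_def by simp
  have s_less: "s i < k" if "i < k" for i
    unfolding s_def using card_line_multi[OF that, of "L i \<inter> Q"] Q(3) by blast
  \<comment> \<open>Joining \<open>p\<close> to the points of a line missing it uses distinct lines
    through \<open>p\<close>. The injection is kept, not just the inequality, because in the
    equality case its surjectivity is needed.\<close>
  have emb: "\<exists>f. inj_on f (L i \<inter> Q) \<and> f ` (L i \<inter> Q) \<subseteq> lines p \<and> (\<forall>x\<in>L i \<inter> Q. x \<in> L (f x))"
    if p: "p \<in> Q" "i < k" "p \<notin> L i" for p i
  proof -
    have "\<exists>j<k. p \<in> L j \<and> x \<in> L j" if "x \<in> L i \<inter> Q" for x using joined[of p x] p that by blast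
    then obtain f where f: "\<And>x. x \<in> L i \<inter> Q \<Longrightarrow> f x < k \<and> p \<in> L (f x) \<and> x \<in> L (f x)" by metis
    have "inj_on f (L i \<inter> Q)"
    proof (rule inj_onI)
      fix x y assume xy: "x \<in> L i \<inter> Q" "y \<in> L i \<inter> Q" "f x = f y"
      have "i \<noteq> f x" using f[OF xy(1)] p(3) by blast
      then show "x = y" using line_Int[of i "f x" x y] f[OF xy(1)] f[OF xy(2)] xy p(2) by auto
    qed
    moreover have "f ` (L i \<inter> Q) \<subseteq> lines p" using f unfolding lines_def by blast
    ultimately show ?thesis using f by blast
  qed
  have s_le_r: "s i \<le> r p" if "p \<in> Q" "i < k" "p \<notin> L i" for p i
    using emb[OF that] card_inj_on_le[OF _ _ fin_lines] unfolding s_def r_def by blast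
  have r_less: "r p < k" if "i < k" "p \<notin> L i" for p i
  proof -
    have "lines p \<subset> {..<k}" using that unfolding lines_def by blast
    then show ?thesis unfolding r_def using psubset_card_mono[of "{..<k}" "lines p"] by simp
  qed
  define f where "f p i = 1 / (real k - real (r p)) - 1 / (real k - real (s i))" for p i
  let ?N = "\<lambda>p. {i \<in> {..<k}. p \<notin> L i}"
  have f_nonneg: "0 \<le> f p i" if "p \<in> Q" "i \<in> ?N p" for p i
  proof -
    have "s i \<le> r p" "r p < k" using s_le_r r_less that by auto
    then show ?thesis unfolding f_def by (simp add: frac_le)
  qed
  have S1: "(\<Sum>p\<in>Q. \<Sum>i\<in>?N p. 1 / (real k - real (r p))) \<le> real k"
  proof -
    \<comment> \<open>The \<open>k - r p\<close> equal terms add up to 1, or to 0 if every line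
      passes through \<open>p\<close>; hence only an inequality.\<close>
    have "(\<Sum>i\<in>?N p. 1 / (real k - real (r p))) \<le> 1" for p
    proof -
      have "?N p = {..<k} - lines p" unfolding lines_def by blast
      then have "card (?N p) = k - r p"
        unfolding r_def using card_Diff_subset[OF fin_lines, of p "{..<k}"] unfolding lines_def by auto
      moreover have "r p \<le> k" unfolding r_def lines_def
        using card_mono[of "{..<k}" "{i. i < k \<and> p \<in> L i}"] by auto
      ultimately show ?thesis by (simp add: of_nat_diff)
    qed
    then have "(\<Sum>p\<in>Q. \<Sum>i\<in>?N p. 1 / (real k - real (r p))) \<le> (\<Sum>p\<in>Q. 1)" by (intro sum_mono)
    then show ?thesis using Q(2) by simp
  qed
  have S2: "(\<Sum>p\<in>Q. \<Sum>i\<in>?N p. 1 / (real k - real (s i))) = real k"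
  proof -
    have "(\<Sum>p\<in>Q. \<Sum>i\<in>?N p. 1 / (real k - real (s i)))
        = (\<Sum>i\<in>{..<k}. \<Sum>p\<in>{p \<in> Q. p \<notin> L i}. 1 / (real k - real (s i)))"
      using sum.swap_restrict[of Q "{..<k}" "\<lambda>p i. 1 / (real k - real (s i))" "\<lambda>p i. p \<notin> L i"] Q(1) by simp
    also have "\<dots> = (\<Sum>i\<in>{..<k}. 1)"
    proof (rule sum.cong[OF refl])
      fix i assume i: "i \<in> {..<k}"
      have "{p \<in> Q. p \<notin> L i} = Q - (L i \<inter> Q)" by blast
      then have "card {p \<in> Q. p \<notin> L i} = k - s i"
        unfolding s_def using card_Diff_subset[of "L i \<inter> Q" Q] Q(1,2) by simp
      then show "(\<Sum>p\<in>{p \<in> Q. p \<notin> L i}. 1 / (real k - real (s i))) = 1"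
        using s_less[of i] i by (simp add: of_nat_diff)
    qed
    finally show ?thesis by simp
  qed
  have "(\<Sum>p\<in>Q. \<Sum>i\<in>?N p. f p i) \<le> 0"
    unfolding f_def using S1 S2 by (simp add: sum_subtractf)
  moreover have "0 \<le> (\<Sum>i\<in>?N p. f p i)" if "p \<in> Q" for p using f_nonneg that by (intro sum_nonneg)
  ultimately have "(\<Sum>i\<in>?N p. f p i) = 0" if "p \<in> Q" for p
    using sum_nonneg_eq_0_iff[OF Q(1), of "\<lambda>p. \<Sum>i\<in>?N p. f p i"] that
    by (meson dual_order.antisym sum_nonneg)
  then have f0: "f p i = 0" if "p \<in> Q" "i < k" "p \<notin> L i" for p i
    using sum_nonneg_eq_0_iff[of "?N p" "f p"] f_nonneg that by auto
  have eq: "s i = r p" if p: "p \<in> Q" "i < k" "p \<notin> L i" for p i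
  proof -
    have "inverse (real k - real (s i)) = inverse (real k - real (r p))"
      using f0[OF p] unfolding f_def by (simp add: inverse_eq_divide)
    then have "real k - real (s i) = real k - real (r p)" by (rule inverse_eq_imp_eq)
    then show ?thesis by simp
  qed
  \<comment> \<open>With \<open>s i = r p\<close> the injection is onto \<open>lines p\<close>, so
    \<open>L j\<close> is one of the lines joining \<open>p\<close> to a point of
    \<open>L i\<close>.\<close>
  have meet: "\<exists>x\<in>Q. x \<in> L i \<and> x \<in> L j" if p: "p \<in> Q" "i < k" "p \<notin> L i" "j < k" "p \<in> L j" for p i j
  proof -
    obtain g where g: "inj_on g (L i \<inter> Q)" "g ` (L i \<inter> Q) \<subseteq> lines p" "\<forall>x\<in>L i \<inter> Q. x \<in> L (g x)"
      using emb[OF p(1-3)] by blast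
    have "card (g ` (L i \<inter> Q)) = card (lines p)"
      using card_image[OF g(1)] eq[OF p(1-3)] unfolding s_def r_def by simp
    then have "g ` (L i \<inter> Q) = lines p" using card_subset_eq[OF fin_lines g(2)] by simp
    moreover have "j \<in> lines p" using p unfolding lines_def by blast
    ultimately obtain x where "x \<in> L i \<inter> Q" "g x = j" by (metis imageE)
    then show ?thesis using g(3) by blast
  qed
  assume "\<not> multi L k \<subseteq> Q"
  then obtain x i j where x: "x \<notin> Q" "i < k" "j < k" "i \<noteq> j" "x \<in> L i" "x \<in> L j"
    unfolding multi_def by blast
  \<comment> \<open>The aim is a point of \<open>Q\<close> on \<open>L j\<close> off
    \<open>L i\<close>, since then \<open>meet\<close> puts a common point of \<open>L i\<close> and
    \<open>L j\<close> into \<open>Q\<close>, different from \<open>x\<close>. A point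
    \<open>q\<close> off \<open>L j\<close> has degree at least 2, so \<open>L j\<close> carries two
    points of \<open>Q\<close>, and \<open>L i\<close> contains at most one of them.\<close>
  have "\<not> Q \<subseteq> L j"
  proof
    assume "Q \<subseteq> L j"
    then have "L j \<inter> Q = Q" by blast
    then show False using s_less[OF x(3)] Q(2) unfolding s_def by simp
  qed
  then obtain q where q: "q \<in> Q" "q \<notin> L j" by blast
  obtain a b where "a < k" "b < k" "a \<noteq> b" "q \<in> L a" "q \<in> L b"
    using q(1) Q(3) unfolding multi_def by blast
  then have "{a, b} \<subseteq> lines q" "card {a, b} = 2" unfolding lines_def by auto
  then have "2 \<le> r q" unfolding r_def using card_mono[OF fin_lines] by metis
  then have two: "2 \<le> card (L j \<inter> Q)" using eq[OF q(1) x(3) q(2)] unfolding s_def by simp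
  have "\<not> L j \<inter> Q \<subseteq> L i"
  proof
    assume sub: "L j \<inter> Q \<subseteq> L i"
    have "y = z" if "y \<in> L j \<inter> Q" "z \<in> L j \<inter> Q" for y z
      using line_Int[OF x(3,2), of y z] x(4) sub that by blast
    then have "card (L j \<inter> Q) \<le> 1" by (metis card.empty card_le_Suc0_iff_eq One_nat_def card.infinite le0)
    then show False using two by simp
  qed
  then obtain p where p: "p \<in> Q" "p \<in> L j" "p \<notin> L i" by blast
  obtain y where "y \<in> Q" "y \<in> L i" "y \<in> L j" using meet[OF p(1) x(2) p(3) x(3) p(2)] by blast
  then show False using line_Int[OF x(2,3,4), of x y] x by blast
qed

end

section \<open>Degeneracy of the union of cliques and both bounds on \<open>chi_DP\<close>\<close>

theorem theorem3p2:
  fixes V :: "'a set" and E :: "'a set set" and k :: nat and L :: "nat \<Rightarrow> 'a set"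
  assumes "k > 0"
    and "simple_graph V E"
    and "graph_NC V E"
    and "\<And>i. i < k \<Longrightarrow> L i \<subseteq> V \<and> card (L i) = k"
    and "\<And>i j. i < k \<Longrightarrow> j < k \<Longrightarrow> i \<noteq> j \<Longrightarrow> clique_edges (L i) \<inter> clique_edges (L j) = {}"
    and "V = (\<Union>i<k. L i)"
    and "E = (\<Union>i<k. clique_edges (L i))"
  shows "chi_DP V E = k"
proof -
  have finV: "finite V" using assms(2) unfolding simple_graph_def by simp
  have edge: "{x, y} \<in> E \<longleftrightarrow> x \<noteq> y \<and> (\<exists>i<k. x \<in> L i \<and> y \<in> L i)" for x y
    unfolding assms(7) clique_edges_def by (auto simp: doubleton_eq_iff)
  interpret sym_graph "\<lambda>x y. {x, y} \<in> E"
    by unfold_locales (simp add: insert_commute, metis edge)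
  have line_Int: "x = y" if ij: "i < k" "j < k" "i \<noteq> j" and xy: "x \<in> L i" "x \<in> L j" "y \<in> L i" "y \<in> L j" for i j x y
  proof (rule ccontr)
    assume "x \<noteq> y"
    then have "{x, y} \<in> clique_edges (L i) \<inter> clique_edges (L j)" using xy unfolding clique_edges_def by blast
    then show False using assms(5)[OF ij] by simp
  qed
  obtain X where X: "hole_cover V E X" "set_NC V E X" using assms(3) unfolding graph_NC_def by blast
  have tr: "transversal V X"
    unfolding transversal_def
  proof (intro allI impI)
    fix H assume H: "hole H" "H \<subseteq> V"
    have h: "is_hole V E H" by (rule is_hole_of_hole[OF H]) simp
    have "H \<inter> X \<noteq> {}" using X(1) h unfolding hole_cover_def by simp
    moreover have "card (H \<inter> X) \<le> 1" using X(2) h unfolding set_NC_def by simp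
    moreover have "finite (H \<inter> X)" using H(2) finV finite_subset by blast
    ultimately have "card (H \<inter> X) = 1" by (metis card_0_eq le_antisym less_one not_le)
    then show "\<exists>x. H \<inter> X = {x}" by (rule card_1_singletonE) simp
  qed
  have NC: "NC_vertex V u" if u: "u \<in> X" for u
    unfolding NC_vertex_def
  proof (intro allI impI notI)
    fix H H' assume H: "hole H" "H \<subseteq> V" "u \<in> H" and H': "hole H'" "H' \<subseteq> V" "u \<notin> H'"
      and sh: "share_P3 H' H"
    have "is_hole V E H" by (rule is_hole_of_hole[OF H(1,2)]) simp
    moreover have "is_hole V E H'" by (rule is_hole_of_hole[OF H'(1,2)]) simp
    moreover obtain p a q where "p \<noteq> q" "{p, a} \<in> E" "{a, q} \<in> E" "{p, a, q} \<subseteq> H'" "{p, a, q} \<subseteq> H"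
      using sh unfolding share_P3_def by auto
    then have "share_two_consecutive_edges E H H'"
      unfolding share_two_consecutive_edges_def by (intro exI[of _ p] exI[of _ a] exI[of _ q]) simp
    moreover have "vertex_NC V E u" using X(2) u unfolding set_NC_def by simp
    ultimately show False using H(3) H'(3) unfolding vertex_NC_def by metis
  qed
  have att: "att {v} \<inter> W = {w \<in> W. {v, w} \<in> E}" for v W unfolding att_def by auto
  have deg: "\<exists>v\<in>W. card {w \<in> W. {v, w} \<in> E} < k" if W: "W \<subseteq> V" "W \<noteq> {}" for W
  proof -
    have finW: "finite W" using W(1) finV finite_subset by blast
    have few: "card {w \<in> W. {v, w} \<in> E} < k"
      if "finite S" "card S = k" "v \<in> S" "{w \<in> W. {v, w} \<in> E} \<subseteq> S" for v S
    proof -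
      have "{w \<in> W. {v, w} \<in> E} \<subseteq> S - {v}" using that(4) edge by auto
      then have "card {w \<in> W. {v, w} \<in> E} \<le> card (S - {v})" using that(1) by (intro card_mono) auto
      also have "\<dots> < k" using card_Diff1_less[OF that(1,3)] that(2) by simp
      finally show ?thesis .
    qed
    show ?thesis
    proof (cases "W \<subseteq> multi L k")
      case False
      then obtain v where v: "v \<in> W" "v \<notin> multi L k" by blast
      then obtain i where i: "i < k" "v \<in> L i" using W(1) assms(6) by blast
      have "{w \<in> W. {v, w} \<in> E} \<subseteq> L i"
      proof
        fix w assume "w \<in> {w \<in> W. {v, w} \<in> E}"
        then have "{v, w} \<in> E" by simp
        then obtain j where j: "j < k" "v \<in> L j" "w \<in> L j" using edge[of v w] by auto
        then have "j = i" using v(2) i unfolding multi_def by blast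
        then show "w \<in> L i" using j(3) by simp
      qed
      moreover have "finite (L i)" "card (L i) = k" using assms(4)[OF i(1)] finV finite_subset by auto
      ultimately have "card {w \<in> W. {v, w} \<in> E} < k" using few[of "L i" v] i(2) by simp
      then show ?thesis using v(1) by blast
    next
      case multi: True
      show ?thesis
      proof (cases "\<exists>Q\<subseteq>W. clq Q \<and> k \<le> card Q")
        case True
        then obtain Q0 where Q0: "Q0 \<subseteq> W" "clq Q0" "k \<le> card Q0" by blast
        obtain Q where Q: "Q \<subseteq> Q0" "card Q = k" "finite Q" using Q0(3) by (rule obtain_subset_with_card_n)
        have QW: "Q \<subseteq> multi L k" using Q(1) Q0(1) multi by blast
        have join: "\<exists>i<k. x \<in> L i \<and> y \<in> L i" if "x \<in> Q" "y \<in> Q" "x \<noteq> y" for x y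
          using clqD[OF Q0(2), of x y] that Q(1) edge[of x y] by auto
        have "multi L k \<subseteq> Q" using clique_absorbs_multi[OF line_Int Q(3,2) QW join] .
        then have "W \<subseteq> Q" using multi by blast
        moreover obtain v where "v \<in> W" using W(2) by blast
        moreover have "card {w \<in> W. {v, w} \<in> E} < k" by (rule few[OF Q(3,2)]) (use calculation in auto)
        ultimately show ?thesis by blast
      next
        case False
        have "card K \<le> k - 1" if "K \<subseteq> W" "clq K" for K
        proof -
          have "\<not> k \<le> card K" using False that by blast
          then show ?thesis by simp
        qed
        moreover have "clq {}" unfolding clq_def by simp
        moreover have "\<not> W \<subseteq> {}" using W(2) by simp
        \<comment> \<open>Any vertex of \<open>W\<close> will do, so the clique to be avoided is
          empty. Degree at most \<open>k - 1\<close> means below \<open>k\<close> because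
          \<open>k\<close> is positive.\<close>
        ultimately obtain v where "v \<in> W" "card (att {v} \<inter> W) \<le> k - 1"
          using NC_low_degree[OF finW transversal_subset[OF tr W(1)] NC_vertex_subset[OF NC W(1)], of "k - 1" "{}"]
          by auto
        then show ?thesis using assms(1) unfolding att by (intro bexI[of _ v]) auto
      qed
    qed
  qed
  show ?thesis
    unfolding chi_DP_def
  proof (rule Least_equality)
    show "dp_colourable V E k" using degenerate_dp_colourable[OF finV deg] .
  next
    fix m assume m: "dp_colourable V E m"
    show "k \<le> m"
    proof (rule ccontr)
      assume "\<not> k \<le> m"
      then have "m < card (L 0)" using assms(4)[OF assms(1)] by simp
      moreover have "L 0 \<subseteq> V" using assms(4)[OF assms(1)] by simp
      moreover have "clique_edges (L 0) \<subseteq> E" using assms(1) unfolding assms(7) by blast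
      ultimately show False using clique_not_dp_colourable[OF finV] m by blast
    qed
  qed
qed

end
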